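(* Let $\mathcal{G}$ be a topological group which is a free amalgamated product $O *_{O\cap L} L$ of two closed subgroups $O, L$. Let $G$ be a Lie group with finitely many connected components and let $\varphi\colon G\to\mathcal{G}$ be a continuous group homomorphism. Then $\varphi(G)$ is conjugate in $\mathcal{G}$ to a subgroup of $O$ or to a subgroup of $L$.
   Context: Lie groups are finite-dimensional real Lie groups. That $\mathcal{G}$ is the free amalgamated product $O *_{O\cap L} L$ of its subgroups $O$ and $L$ is meant in the sense of abstract groups: the canonical homomorphism from the amalgamated free product of $O$ and $L$ over their common subgroup $O\cap L$ to $\mathcal{G}$, induced by the inclusions, is an isomorphism. The topology enters only through $\mathcal{G}$ being a topological group in which $O$ and $L$ are closed. *)

theory Defs
  imports "HOL-Analysis.Analysis" "HOL-Algebra.Algebra"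
begin

section \<open>Topological groups\<close>

definition topological_group :: "('a, 'm) monoid_scheme \<Rightarrow> 'a topology \<Rightarrow> bool" where
  "topological_group G T \<longleftrightarrow>
     group G \<and> topspace T = carrier G \<and>
     continuous_map (prod_topology T T) T (\<lambda>(x, y). x \<otimes>\<^bsub>G\<^esub> y) \<and>
     continuous_map T T (\<lambda>x. inv\<^bsub>G\<^esub> x)"


section \<open>Amalgamated free products\<close>

text \<open>
  For homomorphisms \<open>i : C \<rightarrow> A\<close> and \<open>j : C \<rightarrow> B\<close>, the amalgamated free product of \<open>A\<close> and \<open>B\<close>
  over \<open>C\<close> is the monoid of words in the disjoint union of \<open>A\<close> and \<open>B\<close>, modulo the congruence
  generated by the multiplication tables of \<open>A\<close> and \<open>B\<close> and by \<open>i c = j c\<close>. As \<open>A\<close> and \<open>B\<close> are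
  groups, so is this quotient, and it is the pushout in the category of groups.
\<close>

definition amalg_words :: "('a, 'm) monoid_scheme \<Rightarrow> ('b, 'n) monoid_scheme \<Rightarrow> ('a + 'b) list set" where
  "amalg_words A B = lists (carrier A <+> carrier B)"

inductive amalg_eq ::
  "('a, 'm) monoid_scheme \<Rightarrow> ('b, 'n) monoid_scheme \<Rightarrow> ('c, 'k) monoid_scheme \<Rightarrow>
   ('c \<Rightarrow> 'a) \<Rightarrow> ('c \<Rightarrow> 'b) \<Rightarrow> ('a + 'b) list \<Rightarrow> ('a + 'b) list \<Rightarrow> bool"
  for A B C i j where
  refl: "w \<in> amalg_words A B \<Longrightarrow> amalg_eq A B C i j w w"
| sym: "amalg_eq A B C i j u v \<Longrightarrow> amalg_eq A B C i j v u"
| trans: "amalg_eq A B C i j u v \<Longrightarrow> amalg_eq A B C i j v w \<Longrightarrow> amalg_eq A B C i j u w"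
| append: "amalg_eq A B C i j u u' \<Longrightarrow> amalg_eq A B C i j v v' \<Longrightarrow> amalg_eq A B C i j (u @ v) (u' @ v')"
| mult_left: "a \<in> carrier A \<Longrightarrow> a' \<in> carrier A \<Longrightarrow>
    amalg_eq A B C i j [Inl a, Inl a'] [Inl (a \<otimes>\<^bsub>A\<^esub> a')]"
| mult_right: "b \<in> carrier B \<Longrightarrow> b' \<in> carrier B \<Longrightarrow>
    amalg_eq A B C i j [Inr b, Inr b'] [Inr (b \<otimes>\<^bsub>B\<^esub> b')]"
| one_left: "amalg_eq A B C i j [Inl \<one>\<^bsub>A\<^esub>] []"
| one_right: "amalg_eq A B C i j [Inr \<one>\<^bsub>B\<^esub>] []"
| glue: "c \<in> carrier C \<Longrightarrow> amalg_eq A B C i j [Inl (i c)] [Inr (j c)]"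

definition amalgamated_free_product ::
  "('a, 'm) monoid_scheme \<Rightarrow> ('b, 'n) monoid_scheme \<Rightarrow> ('c, 'k) monoid_scheme \<Rightarrow>
   ('c \<Rightarrow> 'a) \<Rightarrow> ('c \<Rightarrow> 'b) \<Rightarrow> ('a + 'b) list set monoid" where
  "amalgamated_free_product A B C i j =
     (let r = {(u, v). amalg_eq A B C i j u v} in
      \<lparr>carrier = amalg_words A B // r,
       mult = (\<lambda>P Q. r `` {x @ y | x y. x \<in> P \<and> y \<in> Q}),
       one = r `` {[]}\<rparr>)"

fun amalg_eval :: "('d, 'm) monoid_scheme \<Rightarrow> ('a \<Rightarrow> 'd) \<Rightarrow> ('b \<Rightarrow> 'd) \<Rightarrow> ('a + 'b) list \<Rightarrow> 'd" where
  "amalg_eval G f g [] = \<one>\<^bsub>G\<^esub>"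
| "amalg_eval G f g (Inl a # w) = f a \<otimes>\<^bsub>G\<^esub> amalg_eval G f g w"
| "amalg_eval G f g (Inr b # w) = g b \<otimes>\<^bsub>G\<^esub> amalg_eval G f g w"

text \<open>
  The homomorphism induced by \<open>f : A \<rightarrow> G\<close> and \<open>g : B \<rightarrow> G\<close> with \<open>f \<circ> i = g \<circ> j\<close>; it is
  well defined because \<open>amalg_eval\<close> is then constant on each class, as shown below.
\<close>

definition amalg_lift ::
  "('d, 'm) monoid_scheme \<Rightarrow> ('a \<Rightarrow> 'd) \<Rightarrow> ('b \<Rightarrow> 'd) \<Rightarrow> ('a + 'b) list set \<Rightarrow> 'd" where
  "amalg_lift G f g P = the_elem (amalg_eval G f g ` P)"

definition is_amalgamated_product_of_subgroups :: "('a, 'm) monoid_scheme \<Rightarrow> 'a set \<Rightarrow> 'a set \<Rightarrow> bool" where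
  "is_amalgamated_product_of_subgroups G H K \<longleftrightarrow>
     subgroup H G \<and> subgroup K G \<and>
     amalg_lift G (\<lambda>x. x) (\<lambda>x. x) \<in>
       iso (amalgamated_free_product
              (G\<lparr>carrier := H\<rparr>) (G\<lparr>carrier := K\<rparr>) (G\<lparr>carrier := H \<inter> K\<rparr>) (\<lambda>x. x) (\<lambda>x. x)) G"

lemma amalg_eq_words:
  assumes "group A" "group B" "i \<in> carrier C \<rightarrow> carrier A" "j \<in> carrier C \<rightarrow> carrier B"
    and "amalg_eq A B C i j u v"
  shows "u \<in> amalg_words A B \<and> v \<in> amalg_words A B"
  using assms(5)
proof induction
  case (glue c)
  then show ?case using assms(3,4) by (auto simp: amalg_words_def)
qed (use assms(1,2) in \<open>auto simp: amalg_words_def group.is_monoid monoid.m_closed monoid.one_closed\<close>)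

lemma amalg_eq_equiv:
  assumes "group A" "group B" "i \<in> carrier C \<rightarrow> carrier A" "j \<in> carrier C \<rightarrow> carrier B"
  shows "equiv (amalg_words A B) {(u, v). amalg_eq A B C i j u v}"
  using amalg_eq_words[OF assms]
  by (intro equivI refl_onI symI transI) (auto intro: amalg_eq.intros)

lemma amalg_eval_closed:
  assumes "group G" "f \<in> carrier A \<rightarrow> carrier G" "g \<in> carrier B \<rightarrow> carrier G" "w \<in> amalg_words A B"
  shows "amalg_eval G f g w \<in> carrier G"
  using assms(4) unfolding amalg_words_def
proof (induction w)
  case Nil
  then show ?case using assms(1) by (simp add: group.is_monoid)
next
  case (Cons s w)
  then show ?case
    using assms(2,3) by (cases s) (auto intro!: monoid.m_closed[OF group.is_monoid[OF assms(1)]])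
qed

lemma amalg_eval_append:
  assumes "group G" "f \<in> carrier A \<rightarrow> carrier G" "g \<in> carrier B \<rightarrow> carrier G"
    and "u \<in> amalg_words A B" "v \<in> amalg_words A B"
  shows "amalg_eval G f g (u @ v) = amalg_eval G f g u \<otimes>\<^bsub>G\<^esub> amalg_eval G f g v"
  using assms(4)
proof (induction u)
  case Nil
  then show ?case using amalg_eval_closed[OF assms(1-3,5)] assms(1) by (simp add: group.is_monoid)
next
  case (Cons s u)
  then have "u \<in> amalg_words A B" and s: "s \<in> carrier A <+> carrier B"
    by (auto simp: amalg_words_def)
  then show ?case
    using Cons.IH s assms(2,3) amalg_eval_closed[OF assms(1-3,5)] amalg_eval_closed[OF assms(1-3)]
    by (cases s) (auto simp: monoid.m_assoc[OF group.is_monoid[OF assms(1)]] Pi_iff)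
qed

lemma amalg_eval_eq:
  assumes G: "group G" and "group A" "group B" "i \<in> carrier C \<rightarrow> carrier A" "j \<in> carrier C \<rightarrow> carrier B"
    and f: "f \<in> hom A G" and g: "g \<in> hom B G" and fg: "\<And>c. c \<in> carrier C \<Longrightarrow> f (i c) = g (j c)"
    and "amalg_eq A B C i j u v"
  shows "amalg_eval G f g u = amalg_eval G f g v"
proof -
  have fc: "f \<in> carrier A \<rightarrow> carrier G" and gc: "g \<in> carrier B \<rightarrow> carrier G"
    using f g by (auto simp: hom_def)
  note words = amalg_eq_words[OF assms(2-5)]
  have r: "x \<otimes>\<^bsub>G\<^esub> \<one>\<^bsub>G\<^esub> = x" if "x \<in> carrier G" for x
    using that G by (simp add: group.is_monoid)
  show ?thesis
    using assms(9)
  proof induction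
    case (append u u' v v')
    then show ?case using amalg_eval_append[OF G fc gc] words by metis
  next
    case (mult_left a a')
    then show ?case using f fc G assms(2)
      by (auto simp: r Pi_iff hom_mult group.is_monoid monoid.m_closed)
  next
    case (mult_right b b')
    then show ?case using g gc G assms(3)
      by (auto simp: r Pi_iff hom_mult group.is_monoid monoid.m_closed)
  next
    case one_left
    then show ?case using hom_one[OF f assms(2) G] G by (simp add: group.is_monoid)
  next
    case one_right
    then show ?case using hom_one[OF g assms(3) G] G by (simp add: group.is_monoid)
  next
    case (glue c)
    then show ?case using fg by simp
  qed auto
qed

lemma amalg_lift_class:
  assumes "group G" "group A" "group B" "i \<in> carrier C \<rightarrow> carrier A" "j \<in> carrier C \<rightarrow> carrier B"
    and "f \<in> hom A G" "g \<in> hom B G" "\<And>c. c \<in> carrier C \<Longrightarrow> f (i c) = g (j c)"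
    and "w \<in> amalg_words A B"
  shows "amalg_lift G f g ({(u, v). amalg_eq A B C i j u v} `` {w}) = amalg_eval G f g w"
proof -
  have "amalg_eval G f g ` ({(u, v). amalg_eq A B C i j u v} `` {w}) = {amalg_eval G f g w}"
    using amalg_eval_eq[OF assms(1-8)] amalg_eq.refl[OF assms(9)] by fastforce
  then show ?thesis by (simp add: amalg_lift_def)
qed


section \<open>Smooth manifolds and Lie groups\<close>

text \<open>
  Only meaningful for open \<open>S\<close> in a finite-dimensional space; there, differentiability \<open>k\<close> times
  can be tested on directional derivatives.
\<close>

primrec times_differentiable_on ::
  "nat \<Rightarrow> 'a::real_normed_vector set \<Rightarrow> ('a \<Rightarrow> 'b::real_normed_vector) \<Rightarrow> bool" where
  "times_differentiable_on 0 S f \<longleftrightarrow> continuous_on S f"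
| "times_differentiable_on (Suc k) S f \<longleftrightarrow>
     (\<forall>x\<in>S. f differentiable (at x)) \<and>
     (\<forall>v. times_differentiable_on k S (\<lambda>x. frechet_derivative f (at x) v))"

definition smooth_on :: "'a::real_normed_vector set \<Rightarrow> ('a \<Rightarrow> 'b::real_normed_vector) \<Rightarrow> bool" where
  "smooth_on S f \<longleftrightarrow> (\<forall>k. times_differentiable_on k S f)"

text \<open>
  A chart is a pair of its domain and a coordinate map, whose values outside the domain are
  irrelevant. The type \<open>'e\<close> is the model space. It is merely required to be finite-dimensional,
  and not of class \<open>euclidean_space\<close>, since the latter would exclude dimension zero.
\<close>

type_synonym ('a, 'e) chart = "'a set \<times> ('a \<Rightarrow> 'e)"

definition is_chart :: "'a topology \<Rightarrow> ('a, 'e::real_normed_vector) chart \<Rightarrow> bool" where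
  "is_chart T = (\<lambda>(U, f). openin T U \<and> open (f ` U) \<and>
     homeomorphic_map (subtopology T U) (top_of_set (f ` U)) f)"

text \<open>
  The atlas need not be maximal. Second countability is not required: for Lie groups with
  finitely many components it is automatic.
\<close>

definition smooth_manifold :: "'a topology \<Rightarrow> ('a, 'e::real_normed_vector) chart set \<Rightarrow> bool" where
  "smooth_manifold T \<A> \<longleftrightarrow>
     (\<exists>B::'e set. finite B \<and> span B = UNIV) \<and>
     Hausdorff_space T \<and>
     (\<forall>c\<in>\<A>. is_chart T c) \<and>
     (\<Union>(U, f)\<in>\<A>. U) = topspace T \<and>
     (\<forall>(U, f)\<in>\<A>. \<forall>(V, g)\<in>\<A>. smooth_on (f ` (U \<inter> V)) (g \<circ> inv_into U f))"

definition prod_atlas ::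
  "('a, 'e) chart set \<Rightarrow> ('b, 'f) chart set \<Rightarrow> ('a \<times> 'b, 'e \<times> 'f) chart set" where
  "prod_atlas \<A> \<B> = {(U \<times> V, map_prod f g) | U f V g. (U, f) \<in> \<A> \<and> (V, g) \<in> \<B>}"

definition smooth_map ::
  "'a topology \<Rightarrow> ('a, 'e::real_normed_vector) chart set \<Rightarrow>
   'b topology \<Rightarrow> ('b, 'f::real_normed_vector) chart set \<Rightarrow> ('a \<Rightarrow> 'b) \<Rightarrow> bool" where
  "smooth_map S \<A> T \<B> F \<longleftrightarrow>
     continuous_map S T F \<and>
     (\<forall>(U, f)\<in>\<A>. \<forall>(V, g)\<in>\<B>. smooth_on (f ` {x \<in> U. F x \<in> V}) (g \<circ> F \<circ> inv_into U f))"

definition lie_group ::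
  "('a, 'm) monoid_scheme \<Rightarrow> 'a topology \<Rightarrow> ('a, 'e::real_normed_vector) chart set \<Rightarrow> bool" where
  "lie_group G T \<A> \<longleftrightarrow>
     group G \<and> topspace T = carrier G \<and> smooth_manifold T \<A> \<and>
     smooth_map (prod_topology T T) (prod_atlas \<A> \<A>) T \<A> (\<lambda>(x, y). x \<otimes>\<^bsub>G\<^esub> y) \<and>
     smooth_map T \<A> T \<A> (\<lambda>x. inv\<^bsub>G\<^esub> x)"


section \<open>Conjugate subgroups\<close>

definition conjugate_subgroups :: "('a, 'm) monoid_scheme \<Rightarrow> 'a set \<Rightarrow> 'a set \<Rightarrow> bool" where
  "conjugate_subgroups G H K \<longleftrightarrow> (\<exists>g\<in>carrier G. K = g <#\<^bsub>G\<^esub> H #>\<^bsub>G\<^esub> inv\<^bsub>G\<^esub> g)"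

end

theory Submission
  imports Defs
begin

text \<open>
  The group \<open>\<G>\<close> acts on the Bass-Serre tree whose vertices are the left cosets of \<open>O1\<close> and of \<open>L1\<close> and
  whose edges join the cosets of a common element. The subgroup \<open>\<phi>(G)\<close> is conjugate into \<open>O1\<close> or \<open>L1\<close> if and
  only if it fixes a vertex, so a fixed point for the action of \<open>G\<close> through \<open>\<phi>\<close> has to be found.

  That the coset graph is a tree is shown by exhibiting, for each edge, a two-colouring of the
  vertices that changes across this edge only (\<open>wall_edges\<close>). It counts modulo two how often a word
  crosses the edge, which is well defined because \<open>\<G>\<close> is the free amalgamated product. Such walls
  imply the four-point condition for the distance (\<open>four_point\<close>), from which everything about
  the geometry of the tree is derived.

  In a Lie group, the identity has a neighbourhood \<open>W\<close> all of whose elements have square roots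
  in \<open>W\<close> (\<open>lie_group_square_roots\<close>). An automorphism of a tree that fixes no vertex and preserves
  the two types of vertices has a positive integral translation length, which doubles under squaring.
  Hence all elements of \<open>W\<close> fix a vertex (\<open>elliptic_if_roots\<close>). Let \<open>V\<close> be a smaller neighbourhood
  with \<open>V V \<subseteq> W\<close>. By Serre's lemma finitely many elements of \<open>V\<close> have a common fixed vertex
  (\<open>finite_common_fixed_point\<close>), and it follows that there is a sequence of vertices such that each element
  of \<open>V\<close> fixes almost all of its terms (\<open>eventually_fixed_sequence\<close>). The stabilisers of vertices in \<open>G\<close>
  are closed, because \<open>O1\<close> and \<open>L1\<close> are closed and \<open>\<phi>\<close> is continuous. As \<open>G\<close> is locally compact, Baire's theorem
  shows that some vertex has an open stabiliser. Its orbit is finite, since \<open>G\<close> has finitely many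
  components, and the centre of a finite orbit is fixed by \<open>G\<close>.
\<close>

section \<open>Trees as connected bipartite graphs with walls\<close>

text \<open>
  A tree is described here by what makes it a tree: every edge is a wall, a two-colouring of the
  vertices that changes across this edge and nowhere else. For the coset graph of an amalgamated
  product such colourings can be written down directly, whereas the absence of circuits would
  require normal forms for words. The function \<open>side\<close> is a fixed bipartition; group actions are
  later required to preserve it, which excludes inversions of edges.
\<close>

locale wall_tree =
  fixes E :: "'v rel" and side :: "'v \<Rightarrow> bool"
  assumes sym_E: "sym E"
    and bipartite: "(x, y) \<in> E \<Longrightarrow> side x \<noteq> side y"
    and connected: "x \<in> Field E \<Longrightarrow> y \<in> Field E \<Longrightarrow> (x, y) \<in> E\<^sup>*"
    and wall: "(x, y) \<in> E \<Longrightarrow> \<exists>u::'v \<Rightarrow> bool. \<forall>a b. (a, b) \<in> E \<longrightarrow> (u a \<noteq> u b) = ({a, b} = {x, y})"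
begin

abbreviation P :: "'v set" where "P \<equiv> Field E"

definition d :: "'v \<Rightarrow> 'v \<Rightarrow> nat" where "d x y = (LEAST n. (x, y) \<in> E ^^ n)"

lemma E_sym: "(x, y) \<in> E \<Longrightarrow> (y, x) \<in> E"
  using sym_E by (auto dest: symD)

lemma E_P: "(x, y) \<in> E \<Longrightarrow> x \<in> P \<and> y \<in> P"
  by (auto simp: Field_def)

lemma relpow_rev: "(x, y) \<in> E ^^ n \<Longrightarrow> (y, x) \<in> E ^^ n"
proof (induction n arbitrary: y)
  case (Suc n)
  then obtain z where "(x, z) \<in> E ^^ n" "(z, y) \<in> E" by auto
  then show ?case using Suc.IH E_sym relpow_Suc_I2 by metis
qed auto

lemma relpow_side: "(x, y) \<in> E ^^ n \<Longrightarrow> even n = (side x = side y)"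
proof (induction n arbitrary: y)
  case (Suc n)
  then obtain z where "(x, z) \<in> E ^^ n" "(z, y) \<in> E" by auto
  then show ?case using Suc.IH[of z] bipartite[of z y] by auto
qed auto

lemma d_path: "x \<in> P \<Longrightarrow> y \<in> P \<Longrightarrow> (x, y) \<in> E ^^ d x y"
  using connected rtrancl_power LeastI_ex unfolding d_def by metis

lemma d_le: "(x, y) \<in> E ^^ n \<Longrightarrow> d x y \<le> n"
  unfolding d_def by (rule Least_le)

lemma d_self [simp]: "d x x = 0"
  using d_le[of x x 0] by simp

lemma d_eq_0: "x \<in> P \<Longrightarrow> y \<in> P \<Longrightarrow> d x y = 0 \<longleftrightarrow> x = y"
  using d_path by fastforce

lemma d_sym: "x \<in> P \<Longrightarrow> y \<in> P \<Longrightarrow> d x y = d y x"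
  by (meson d_le d_path relpow_rev le_antisym)

lemma d_triangle: "x \<in> P \<Longrightarrow> y \<in> P \<Longrightarrow> z \<in> P \<Longrightarrow> d x z \<le> d x y + d y z"
  by (intro d_le) (auto simp: relpow_add intro!: relcompI d_path)

lemma d_even: "x \<in> P \<Longrightarrow> y \<in> P \<Longrightarrow> even (d x y) = (side x = side y)"
  using relpow_side d_path by blast

lemma d_edge: assumes "x \<in> P" "(y, z) \<in> E"
  shows "d x y = Suc (d x z) \<or> d x z = Suc (d x y)"
proof -
  have P: "y \<in> P" "z \<in> P" using assms E_P by auto
  have "d y z \<le> 1" "d z y \<le> 1" using d_le[of _ _ 1] assms E_sym by auto
  then have "d x z \<le> Suc (d x y)" "d x y \<le> Suc (d x z)"
    using d_triangle[OF assms(1) P] d_triangle[OF assms(1) P(2,1)] by auto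
  moreover have "d x y \<noteq> d x z"
    using d_even[OF assms(1)] P bipartite[OF assms(2)] by metis
  ultimately show ?thesis by auto
qed

lemma d_step: assumes "x \<in> P" "y \<in> P" "d x y = Suc n"
  obtains z where "(z, y) \<in> E" "z \<in> P" "d x z = n"
proof -
  obtain z where z: "(x, z) \<in> E ^^ n" "(z, y) \<in> E"
    using d_path[OF assms(1,2)] assms(3) by auto
  then have "d x z = n" using d_le[OF z(1)] d_edge[OF assms(1) z(2)] assms(3) by auto
  then show thesis using that z E_P by blast
qed

text \<open>
  A geodesic from \<open>x\<close> that stays strictly closer to \<open>x\<close> than \<open>v\<close> cannot use an edge at \<open>v\<close>, so it
  does not cross the wall of such an edge.
\<close>

lemma wall_constant:
  assumes u: "\<And>a b. (a, b) \<in> E \<Longrightarrow> u a \<noteq> u b \<Longrightarrow> v \<in> {a, b}"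
    and x: "x \<in> P"
  shows "y \<in> P \<Longrightarrow> d x y < d x v \<Longrightarrow> (u y :: bool) = u x"
proof (induction "d x y" arbitrary: y)
  case 0
  then show ?case using d_eq_0 x by metis
next
  case (Suc n)
  from Suc.hyps(2) obtain z where z: "(z, y) \<in> E" "z \<in> P" "d x z = n"
    using d_step x Suc.prems by metis
  then have "u z = u x" using Suc by simp
  moreover have "v \<notin> {z, y}" using z Suc by auto
  ultimately show ?case using u z by metis
qed

text \<open>
  Two different neighbours of \<open>v\<close> closer to \<open>x\<close> would both lie on the side of \<open>x\<close> of the wall between
  \<open>v\<close> and the first of them. But then the edge from \<open>v\<close> to the second also crosses that wall. This
  is the only place where walls are used; from here on only distances matter.
\<close>

lemma closer_neighbour_unique:
  assumes "x \<in> P" "(w, v) \<in> E" "(w', v) \<in> E" "d x w < d x v" "d x w' < d x v"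
  shows "w = w'"
proof -
  from wall[OF assms(2)] obtain u :: "'v \<Rightarrow> bool" where u: "\<And>a b. (a, b) \<in> E \<Longrightarrow> (u a \<noteq> u b) = ({a, b} = {w, v})"
    by blast
  then have *: "v \<in> {a, b}" if "(a, b) \<in> E" "u a \<noteq> u b" for a b using that by auto
  have "u w = u x" "u w' = u x"
    using wall_constant[of u v x, OF * assms(1)] assms E_P by blast+
  moreover have "u w \<noteq> u v" using u assms by auto
  ultimately have "{w', v} = {w, v}" using u[OF assms(3)] by auto
  then show ?thesis by (auto simp: doubleton_eq_iff)
qed

text \<open>
  In a tree a path without backtracking is geodesic: moving from \<open>y\<close> towards \<open>z\<close>, the distance to \<open>x\<close>
  can never drop again, because the only neighbour closer to \<open>x\<close> is the one just left.
\<close>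

lemma geodesic_concat:
  assumes "x \<in> P" "z \<in> P" "(y', y) \<in> E" "d x y = Suc (d x y')" "d y' z = Suc (d y z)"
  shows "d x z = d x y + d y z"
  using assms(3-)
proof (induction "d y z" arbitrary: y y')
  case 0
  then show ?case using d_eq_0 E_P assms(2) by (metis add.right_neutral)
next
  case (Suc n)
  have y: "y \<in> P" "y' \<in> P" using Suc E_P by auto
  obtain w where w: "(w, y) \<in> E" "w \<in> P" "d z w = n"
    using d_step[of z y n] Suc(2) d_sym y assms(2) by metis
  have "w \<noteq> y'" using w Suc d_sym y assms(2) by auto
  then have "d x w = Suc (d x y)"
    using closer_neighbour_unique[OF assms(1) w(1) Suc(3)] d_edge[OF assms(1) w(1)] Suc(4) by linarith
  moreover have "d w z = n" using w assms(2) d_sym by metis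
  moreover have "d x z = d x w + d w z"
    using Suc(1)[of w y] w E_sym Suc(2) calculation by auto
  ultimately show ?case using Suc(2) by simp
qed

text \<open>
  This inequality, which characterises subsets of real trees among metric spaces, is all that is needed
  below about the geometry of the tree. Moving \<open>y\<close> one step towards \<open>x\<close> either decreases all distances
  involving \<open>y\<close>, or \<open>y\<close> lies on the geodesic from \<open>x\<close> to \<open>z\<close> or to \<open>w\<close>, and then the triangle
  inequality suffices.
\<close>

lemma four_point:
  assumes "x \<in> P" "z \<in> P" "w \<in> P"
  shows "y \<in> P \<Longrightarrow> d x y + d z w \<le> max (d x z + d y w) (d x w + d y z)"
proof (induction "d x y" arbitrary: y)
  case 0
  then have "x = y" using d_eq_0 assms by metis
  then show ?case using d_triangle[OF assms(2,1,3)] d_sym assms by simp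
next
  case (Suc n)
  obtain y' where y': "(y', y) \<in> E" "y' \<in> P" "d x y' = n"
    using d_step[of x y n] Suc assms by metis
  then have xy: "d x y = Suc (d x y')" using Suc by auto
  have e: "d y' v = Suc (d y v) \<or> d y v = Suc (d y' v)" if "v \<in> P" for v
    using d_edge[OF that y'(1)] that d_sym y' Suc(3) by metis
  consider "d y' z = Suc (d y z)" | "d y' w = Suc (d y w)"
    | "d y z = Suc (d y' z)" "d y w = Suc (d y' w)"
    using e assms by blast
  then show ?case
  proof cases
    case 1
    then have "d x z = d x y + d y z" using geodesic_concat[OF assms(1,2) y'(1) xy] by simp
    moreover have "d z w \<le> d y z + d y w"
      using d_triangle[of z y w] d_sym assms Suc by metis
    ultimately show ?thesis by simp
  next
    case 2
    then have "d x w = d x y + d y w" using geodesic_concat[OF assms(1,3) y'(1) xy] by simp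
    moreover have "d z w \<le> d y z + d y w"
      using d_triangle[of z y w] d_sym assms Suc by metis
    ultimately show ?thesis by simp
  next
    case 3
    then show ?thesis using Suc(1)[of y'] y' xy by simp
  qed
qed

lemma between_unique:
  assumes "x \<in> P" "z \<in> P" "a \<in> P" "b \<in> P"
    and "d x a + d a z = d x z" "d x b + d b z = d x z" "d x a = d x b"
  shows "a = b"
proof -
  have "d a b + d x z \<le> max (d a x + d b z) (d a z + d b x)"
    using four_point[of a x z b] assms by auto
  then have "d a b = 0" using assms d_sym[of a x] d_sym[of b x] by simp
  then show ?thesis using d_eq_0 assms by simp
qed

lemma between_exists:
  assumes "x \<in> P"
  shows "y \<in> P \<Longrightarrow> k \<le> d x y \<Longrightarrow> \<exists>m\<in>P. d x m = k \<and> d x m + d m y = d x y"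
proof (induction "d x y - k" arbitrary: y)
  case 0
  then show ?case by (intro bexI[of _ y]) auto
next
  case (Suc n)
  then have "d x y = Suc (d x y - 1)" by simp
  then obtain z where z: "(z, y) \<in> E" "z \<in> P" "d x z = d x y - 1"
    using d_step[OF assms(1) Suc(3)] by metis
  then obtain m where m: "m \<in> P" "d x m = k" "d x m + d m z = d x z"
    using Suc(1)[of z] Suc(2-4) by fastforce
  have "d m y \<le> d m z + 1"
    using d_triangle[of m z y] d_le[of z y 1] z m Suc by fastforce
  moreover have "d x y \<le> d x m + d m y" using d_triangle assms m Suc by blast
  ultimately show ?case using m z Suc(2) by (intro bexI[of _ m]) auto
qed

lemma dist_midpoint:
  assumes "x \<in> P" "y \<in> P" "z \<in> P" "m \<in> P" "d x m = k" "d m y = k" "d x y = 2 * k"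
  shows "d m z + k \<le> max (d x z) (d y z)"
  using four_point[of m x y z] assms d_sym[of m x] d_sym[of m z] d_sym[of z x] d_sym[of z y]
  by (auto simp: max_def split: if_splits)

end

section \<open>Groups acting on trees\<close>

locale tree_action = wall_tree E side + group G
  for E :: "'v rel" and side :: "'v \<Rightarrow> bool" and G :: "('g, 'n) monoid_scheme" (structure) +
  fixes act :: "'g \<Rightarrow> 'v \<Rightarrow> 'v"
  assumes act_edge: "g \<in> carrier G \<Longrightarrow> (x, y) \<in> E \<Longrightarrow> (act g x, act g y) \<in> E"
    and act_mult: "g \<in> carrier G \<Longrightarrow> h \<in> carrier G \<Longrightarrow> x \<in> Field E \<Longrightarrow> act (g \<otimes> h) x = act g (act h x)"
    and act_one: "x \<in> Field E \<Longrightarrow> act \<one> x = x"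
    and act_side: "g \<in> carrier G \<Longrightarrow> x \<in> Field E \<Longrightarrow> side (act g x) = side x"
begin

lemma act_P: "g \<in> carrier G \<Longrightarrow> x \<in> P \<Longrightarrow> act g x \<in> P"
  using act_edge unfolding Field_def by blast

lemma act_inv: "g \<in> carrier G \<Longrightarrow> x \<in> P \<Longrightarrow> act (inv g) (act g x) = x"
  using act_mult[of "inv g" g x] act_one by simp

lemma act_relpow: "g \<in> carrier G \<Longrightarrow> (x, y) \<in> E ^^ n \<Longrightarrow> (act g x, act g y) \<in> E ^^ n"
proof (induction n arbitrary: y)
  case (Suc n)
  then obtain z where z: "(x, z) \<in> E ^^ n" "(z, y) \<in> E" by auto
  from Suc.IH[OF Suc.prems(1) z(1)] act_edge[OF Suc.prems(1) z(2)] show ?case by auto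
qed auto

lemma act_d_le: "g \<in> carrier G \<Longrightarrow> x \<in> P \<Longrightarrow> y \<in> P \<Longrightarrow> d (act g x) (act g y) \<le> d x y"
  by (intro d_le act_relpow d_path)

lemma act_d: "g \<in> carrier G \<Longrightarrow> x \<in> P \<Longrightarrow> y \<in> P \<Longrightarrow> d (act g x) (act g y) = d x y"
  using act_d_le[of g x y] act_d_le[of "inv g" "act g x" "act g y"] by (simp add: act_inv act_P)

lemma d_act_even: "g \<in> carrier G \<Longrightarrow> x \<in> P \<Longrightarrow> even (d x (act g x))"
  using d_even act_side act_P by simp

definition elliptic :: "'g \<Rightarrow> bool" where
  "elliptic g \<longleftrightarrow> (\<exists>x\<in>P. act g x = x)"

lemma fixed_between:
  assumes "g \<in> carrier G" "x \<in> P" "z \<in> P" "a \<in> P" "act g x = x" "act g z = z"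
    and "d x a + d a z = d x z"
  shows "act g a = a"
proof (rule between_unique[of x z])
  show "d x (act g a) + d (act g a) z = d x z" "d x (act g a) = d x a"
    using act_d[of g x a] act_d[of g a z] assms by simp_all
qed (use assms act_P in auto)

text \<open>
  If \<open>g\<close> fixes \<open>z\<close>, it maps the geodesic from \<open>x\<close> to \<open>z\<close> onto the one from \<open>g x\<close> to \<open>z\<close>. The two
  merge at the midpoint of \<open>x\<close> and \<open>g x\<close>. The point of the fixed set of \<open>g\<close> nearest to \<open>x\<close> is therefore this
  midpoint, whatever \<open>z\<close> is.
\<close>

lemma elliptic_midpoint:
  assumes g: "g \<in> carrier G" "x \<in> P" "z \<in> P" "act g z = z"
    and m: "m \<in> P" "d x m = k" "d m (act g x) = k" "d x (act g x) = 2 * k"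
  shows "act g m = m" "d x m + d m z = d x z"
proof -
  have P: "act g x \<in> P" "act g m \<in> P" using assms act_P by auto
  have gz: "d (act g x) z = d x z" using act_d[of g x z] assms by simp
  have "d m z + k \<le> d x z"
    using dist_midpoint[OF g(2) P(1) g(3) m] gz by simp
  moreover have "d x z \<le> k + d m z" using d_triangle[of x m z] assms by simp
  ultimately show b: "d x m + d m z = d x z" using m by simp
  show "act g m = m"
  proof (rule between_unique[OF P(1) g(3) P(2) m(1)])
    have "d (act g x) (act g m) = d x m" "d (act g m) z = d m z"
      using act_d[of g x m] act_d[of g m z] assms by simp_all
    then show "d (act g x) (act g m) + d (act g m) z = d (act g x) z"
      "d (act g x) m + d m z = d (act g x) z" "d (act g x) (act g m) = d (act g x) m"
      using b gz m d_sym[OF m(1) P(1)] by simp_all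
  qed
qed

lemma midpoint_exists:
  assumes "g \<in> carrier G" "x \<in> P"
  obtains m k where "m \<in> P" "d x m = k" "d m (act g x) = k" "d x (act g x) = 2 * k"
proof -
  obtain k where k: "d x (act g x) = 2 * k" using d_act_even[OF assms] by blast
  then obtain m where "m \<in> P" "d x m = k" "d x m + d m (act g x) = 2 * k"
    using between_exists[of x "act g x" k] assms act_P by auto
  then show thesis using that k by auto
qed

text \<open>
  If \<open>g\<^sup>2 x\<close> is no farther from \<open>x\<close> than \<open>g x\<close>, then the geodesics from \<open>g x\<close> to \<open>x\<close> and to \<open>g\<^sup>2 x\<close>
  share their first half, so that \<open>g\<close> maps the midpoint of \<open>x\<close> and \<open>g x\<close> to itself.
\<close>

lemma elliptic_if_no_drift:
  assumes g: "g \<in> carrier G" "x \<in> P" and le: "d x (act g (act g x)) \<le> d x (act g x)"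
  shows "elliptic g"
proof -
  obtain m k where m: "m \<in> P" "d x m = k" "d m (act g x) = k" "d x (act g x) = 2 * k"
    using midpoint_exists[OF g] .
  let ?p = "act g x" and ?z = "act g (act g x)"
  have P: "?p \<in> P" "?z \<in> P" "act g m \<in> P" using g m act_P by auto
  have pz: "d ?p ?z = 2 * k" using act_d[of g x ?p] g P m by simp
  have "d m ?z + k \<le> max (d x ?z) (d ?p ?z)"
    using dist_midpoint[OF g(2) P(1,2) m] .
  then have "d m ?z \<le> k" using le m pz by simp
  moreover have "d ?p m = k" using m d_sym P by metis
  moreover have "d ?p ?z \<le> d ?p m + d m ?z" using d_triangle P m by blast
  ultimately have "d ?p m + d m ?z = d ?p ?z" using pz by simp
  moreover have "d ?p (act g m) = k" "d (act g m) ?z = k"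
    using act_d[of g x m] act_d[of g m ?p] g P m by simp_all
  ultimately have "act g m = m"
    using between_unique[OF P(1,2,3) m(1)] pz \<open>d ?p m = k\<close> by simp
  then show ?thesis using m by (auto simp: elliptic_def)
qed

text \<open>
  Otherwise \<open>g\<close> translates along an axis, the translation length is the difference
  \<open>d x (g\<^sup>2 x) - d x (g x)\<close>, and the translation length of \<open>g\<^sup>2\<close> is twice that of \<open>g\<close>. Natural number
  subtraction is avoided by moving the negative terms to the other side.
\<close>

lemma drift_doubles:
  assumes g: "g \<in> carrier G" "x \<in> P" and less: "d x (act g x) < d x (act g (act g x))"
  shows "d x (act (g \<otimes> g) (act (g \<otimes> g) x)) + 2 * d x (act g x)
       = d x (act (g \<otimes> g) x) + 2 * d x (act g (act g x))"
proof -
  let ?a = "d x (act g x)" and ?b = "d x (act g (act g x))"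
  let ?x1 = "act g x" and ?x2 = "act g (act g x)" and ?x3 = "act g (act g (act g x))"
    and ?x4 = "act g (act g (act g (act g x)))"
  have P: "?x1 \<in> P" "?x2 \<in> P" "?x3 \<in> P" "?x4 \<in> P" using g act_P by auto
  have a: "d ?x1 ?x2 = ?a" "d ?x2 ?x3 = ?a" "d ?x3 ?x4 = ?a" "d ?x1 ?x3 = ?b" "d ?x2 ?x4 = ?b"
     "d ?x1 ?x4 = d x ?x3"
    using g P act_d by simp_all
  \<comment> \<open>The four-point condition determines the distances from \<open>x\<close> to \<open>g\<^sup>3 x\<close> and to \<open>g\<^sup>4 x\<close>.\<close>
  have "2 * ?b \<le> max (2 * ?a) (d x ?x3 + ?a)"
    using four_point[of x ?x1 ?x3 ?x2] g P a d_sym[of ?x1 ?x2] d_sym[of ?x2 ?x3] d_sym[of ?x1 ?x3]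
    by (simp add: max_def split: if_splits)
  moreover have "d x ?x3 + ?a \<le> 2 * ?b"
    using four_point[of x ?x1 ?x2 ?x3] g P a less d_sym[of ?x3 ?x2] d_sym[of ?x3 ?x1]
    by (simp add: max_def split: if_splits)
  ultimately have x3: "d x ?x3 + ?a = 2 * ?b" using less by auto
  have "d x ?x3 + d ?x1 ?x4 \<le> max (?a + ?a) (d x ?x4 + ?b)"
    using four_point[of x ?x1 ?x4 ?x3] g P a d_sym[of ?x3 ?x1] by simp
  moreover have "d x ?x4 + ?b \<le> d x ?x3 + d ?x1 ?x4 \<or> d x ?x4 + ?b \<le> ?a + ?a"
    using four_point[of x ?x1 ?x3 ?x4] g P a d_sym[of ?x3 ?x4] d_sym[of ?x1 ?x4]
    by (simp add: max_def split: if_splits)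
  ultimately have "d x ?x4 + 2 * ?a = 3 * ?b" using a x3 less by auto
  then show ?thesis using g P act_mult by simp
qed

lemma elliptic_square:
  assumes "h \<in> carrier G" "elliptic h"
  shows "elliptic (h \<otimes> h)"
  using assms act_mult unfolding elliptic_def by metis

text \<open>
  Translation lengths of non-elliptic elements are positive integers that double under squaring.
  An element with roots of order \<open>2\<^sup>n\<close> for every \<open>n\<close> can therefore not be a translation.
\<close>

lemma elliptic_if_roots:
  assumes S: "S \<subseteq> carrier G" "\<And>g. g \<in> S \<Longrightarrow> \<exists>h\<in>S. h \<otimes> h = g"
    and "g \<in> S" "x \<in> P"
  shows "elliptic g"
proof -
  have *: "elliptic g \<or> d x (act g x) + 2 ^ n \<le> d x (act g (act g x))" if "g \<in> S" for g n
    using that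
  proof (induction n arbitrary: g)
    case 0
    then show ?case using elliptic_if_no_drift[of g x] assms by fastforce
  next
    case (Suc n)
    then obtain h where h: "h \<in> S" "h \<otimes> h = g" using S by blast
    then show ?case
    proof (cases "elliptic h")
      case True
      then show ?thesis using elliptic_square h S by blast
    next
      case False
      then have le: "d x (act h x) + 2 ^ n \<le> d x (act h (act h x))" using Suc.IH h by blast
      moreover have "(0::nat) < 2 ^ n" by simp
      ultimately have "d x (act h x) < d x (act h (act h x))" by linarith
      then have "d x (act g (act g x)) + 2 * d x (act h x) = d x (act g x) + 2 * d x (act h (act h x))"
        using drift_doubles[of h x] h S assms by blast
      then show ?thesis using le by simp
    qed
  qed
  show ?thesis
  proof (rule ccontr)
    assume "\<not> elliptic g"
    then have "(2::nat) ^ (d x (act g (act g x))) \<le> d x (act g (act g x))"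
      using *[OF assms(3)] by (meson add_leD2)
    then show False using less_exp[of "d x (act g (act g x))"] by simp
  qed
qed

definition Fix :: "'g set \<Rightarrow> 'v set" where
  "Fix S = {x \<in> P. \<forall>g\<in>S. act g x = x}"

text \<open>
  Serre's lemma. In the induction step \<open>q\<close> is fixed by \<open>S\<close>, so \<open>g\<close> and \<open>g s\<close> move \<open>q\<close> to the same
  point. Both fix the midpoint of \<open>q\<close> and \<open>g q\<close>, hence so does \<open>s\<close>.
\<close>

lemma finite_common_fixed_point:
  assumes V: "V \<subseteq> carrier G" "\<And>g. g \<in> V \<Longrightarrow> elliptic g"
      "\<And>g h. g \<in> V \<Longrightarrow> h \<in> V \<Longrightarrow> elliptic (g \<otimes> h)" and P: "P \<noteq> {}"
  shows "finite S \<Longrightarrow> S \<subseteq> V \<Longrightarrow> Fix S \<noteq> {}"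
proof (induction S rule: finite_induct)
  case empty
  then show ?case using P by (auto simp: Fix_def)
next
  case (insert g S)
  then obtain q where q: "q \<in> P" "\<And>s. s \<in> S \<Longrightarrow> act s q = q" by (auto simp: Fix_def)
  have g: "g \<in> carrier G" using insert V by auto
  obtain m k where m: "m \<in> P" "d q m = k" "d m (act g q) = k" "d q (act g q) = 2 * k"
    using midpoint_exists[OF g q(1)] .
  obtain z where "z \<in> P" "act g z = z" using V(2)[of g] insert unfolding elliptic_def by blast
  then have gm: "act g m = m" using elliptic_midpoint[OF g q(1) _ _ m] by blast
  have "act s m = m" if "s \<in> S" for s
  proof -
    have s: "s \<in> carrier G" "s \<in> V" using that insert V by auto
    then obtain z where z: "z \<in> P" "act (g \<otimes> s) z = z"
      using V(3)[of g s] insert by (auto simp: elliptic_def)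
    \<comment> \<open>\<open>m\<close> is also the midpoint of \<open>q\<close> and \<open>(g s) q\<close>.\<close>
    have "act (g \<otimes> s) q = act g q" using act_mult g s q that by simp
    then have "act (g \<otimes> s) m = m"
      using elliptic_midpoint(1)[OF _ q(1) z m(1,2)] g s m by simp
    then have "act g (act s m) = act g m" using act_mult g s m gm by simp
    then show ?thesis using act_inv[OF g] act_P s m by metis
  qed
  then have "m \<in> Fix (insert g S)" using gm m by (auto simp: Fix_def)
  then show ?case by blast
qed

text \<open>
  Fixed sets are subtrees. Leaving the nearest point \<open>a\<close> in the direction of \<open>z\<close> stays within the
  fixed set, hence moves away from \<open>q\<close>, so that \<open>a\<close> lies on the geodesic from \<open>q\<close> to \<open>z\<close>.
\<close>

lemma gate:
  assumes "S \<subseteq> carrier G" "Fix S \<noteq> {}" and q: "q \<in> P"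
  shows "\<exists>a\<in>Fix S. \<forall>z\<in>Fix S. d q z = d q a + d a z"
proof -
  obtain a where a: "a \<in> Fix S" and min: "\<And>z. z \<in> Fix S \<Longrightarrow> d q a \<le> d q z"
    using ex_has_least_nat[of "\<lambda>a. a \<in> Fix S" _ "d q"] assms(2) by blast
  have "d q z = d q a + d a z" if z: "z \<in> Fix S" for z
  proof (cases "a = z")
    case False
    have P: "a \<in> P" "z \<in> P" using a z by (auto simp: Fix_def)
    then obtain n where n: "d z a = Suc n" using False d_eq_0 d_sym by (metis not0_implies_Suc)
    then obtain b where b: "(b, a) \<in> E" "b \<in> P" "d z b = n"
      using d_step P by metis
    have "d a b = 1"
      using d_le[of a b 1] E_sym[OF b(1)] bipartite[OF b(1)] d_eq_0[of a b] P b(2) by fastforce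
    then have "d a b + d b z = d a z" using n b P d_sym by (metis plus_1_eq_Suc)
    then have "b \<in> Fix S"
      using fixed_between[of _ a z b] P b a z assms(1) by (auto simp: Fix_def)
    then have "d q b = Suc (d q a)" using min[of b] d_edge[OF q b(1)] by linarith
    moreover have "d a z = Suc (d b z)" using n b P d_sym by metis
    ultimately show ?thesis
      using geodesic_concat[OF q P(2) E_sym[OF b(1)]] by simp
  qed simp
  with a show ?thesis by blast
qed

text \<open>
  Let \<open>a\<close> be the point nearest to \<open>q\<close> in the common fixed set of a finite part of \<open>V\<close>. If such points
  remain at bounded distance from \<open>q\<close>, then one at maximal distance cannot be pushed away by further
  elements, so it is fixed by all of \<open>V\<close>. If not, a sequence of them tends to infinity. Every \<open>g\<close> in
  \<open>V\<close> then fixes almost all of its terms: \<open>g\<close> has a common fixed point \<open>z\<close> with the \<open>n\<close>-th finite part,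
  its fixed set meets the geodesic from \<open>q\<close> to \<open>z\<close> in a final segment that starts at distance
  \<open>d q (g q) / 2\<close> from \<open>q\<close>, and the \<open>n\<close>-th point lies on that segment once it is far enough from \<open>q\<close>.
\<close>

lemma eventually_fixed_sequence:
  assumes V: "V \<subseteq> carrier G" "\<And>g. g \<in> V \<Longrightarrow> elliptic g"
      "\<And>g h. g \<in> V \<Longrightarrow> h \<in> V \<Longrightarrow> elliptic (g \<otimes> h)" and q: "q \<in> P"
  shows "\<exists>a :: nat \<Rightarrow> 'v. (\<forall>n. a n \<in> P) \<and> (\<forall>g\<in>V. \<exists>N. \<forall>n\<ge>N. act g (a n) = a n)"
proof -
  define gt where "gt S a \<longleftrightarrow> a \<in> Fix S \<and> (\<forall>z\<in>Fix S. d q z = d q a + d a z)" for S a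
  have fixne: "Fix S \<noteq> {}" if "finite S" "S \<subseteq> V" for S
    using finite_common_fixed_point[OF V _ that] q by auto
  have gtD: "a \<in> Fix S" "a \<in> P" "\<And>z. z \<in> Fix S \<Longrightarrow> d q z = d q a + d a z" if "gt S a" for S a
    using that unfolding gt_def Fix_def by blast+
  have ex: "\<exists>a. gt S a" if S: "finite S" "S \<subseteq> V" for S
    using gate[OF subset_trans[OF S(2) V(1)] fixne[OF S] q] unfolding gt_def by blast
  define A where "A = {a. \<exists>S. finite S \<and> S \<subseteq> V \<and> gt S a}"
  show ?thesis
  proof (cases "finite (d q ` A)")
    case True
    obtain a0 where "gt {} a0" using ex[of "{}"] by blast
    then have "a0 \<in> A" unfolding A_def by blast
    then have "Max (d q ` A) \<in> d q ` A" using Max_in[OF True] by blast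
    then obtain a where a: "a \<in> A" "Max (d q ` A) = d q a" by blast
    then obtain S where S: "finite S" "S \<subseteq> V" "gt S a" unfolding A_def by blast
    have "act g a = a" if g: "g \<in> V" for g
    proof -
      obtain b where b: "gt (insert g S) b" using ex[of "insert g S"] S g by auto
      moreover have "finite (insert g S)" "insert g S \<subseteq> V" using S g by simp_all
      ultimately have "b \<in> A" unfolding A_def by blast
      then have "d q b \<le> d q a" using Max_ge[OF True, of "d q b"] a(2) by simp
      moreover have "b \<in> Fix S" using gtD(1)[OF b] by (auto simp: Fix_def)
      ultimately have "d a b = 0" using gtD(3)[OF S(3), of b] by linarith
      then have "a = b" using d_eq_0 gtD(2)[OF S(3)] gtD(2)[OF b] by blast
      then show ?thesis using gtD(1)[OF b] by (simp add: Fix_def)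
    qed
    moreover have "a \<in> P" using gtD(2)[OF S(3)] .
    ultimately show ?thesis by (intro exI[of _ "\<lambda>_. a"]) auto
  next
    case False
    have "\<exists>a S. finite S \<and> S \<subseteq> V \<and> gt S a \<and> n \<le> d q a" for n
    proof -
      obtain r where "r \<in> d q ` A" "n \<le> r"
        using False by (meson finite_nat_set_iff_bounded_le nat_le_linear)
      then show ?thesis unfolding A_def by blast
    qed
    then obtain a S where aS: "\<And>n. finite (S n)" "\<And>n. S n \<subseteq> V" "\<And>n. gt (S n) (a n)" "\<And>n. n \<le> d q (a n)"
      by metis
    have aP: "a n \<in> P" for n using gtD(2)[OF aS(3)] .
    have "\<exists>N. \<forall>n\<ge>N. act g (a n) = a n" if g: "g \<in> V" for g
    proof -
      have gG: "g \<in> carrier G" using g V by auto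
      obtain m k where m: "m \<in> P" "d q m = k" "d m (act g q) = k" "d q (act g q) = 2 * k"
        using midpoint_exists[OF gG q] .
      have "act g (a n) = a n" if n: "n \<ge> k" for n
      proof -
        obtain z where z: "z \<in> Fix (insert g (S n))"
          using fixne[of "insert g (S n)"] aS g by blast
        then have zP: "z \<in> P" "act g z = z" "z \<in> Fix (S n)" by (auto simp: Fix_def)
        have z1: "d q z = d q (a n) + d (a n) z" using gtD(3)[OF aS(3) zP(3)] .
        note em = elliptic_midpoint[OF gG q zP(1,2) m]
        have "d m (a n) + d q z \<le> max (d m q + d (a n) z) (d m z + d (a n) q)"
          using four_point[OF m(1) q zP(1) aP[of n]] by (simp add: max.commute)
        moreover have "d m q = k" "d (a n) q = d q (a n)" using d_sym m q aP by auto
        ultimately have "d m (a n) + k \<le> d q (a n)"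
          using z1 em(2) m(2) aS(4)[of n] n by (auto simp: max_def split: if_splits)
        then have "d m (a n) + d (a n) z = d m z"
          using z1 em(2) m(2) d_triangle[OF m(1) aP[of n] zP(1)] by simp
        then show ?thesis
          using fixed_between[OF gG m(1) zP(1) aP[of n] em(1) zP(2)] by simp
      qed
      then show ?thesis by blast
    qed
    then have "\<forall>g\<in>V. \<exists>N. \<forall>n\<ge>N. act g (a n) = a n" by blast
    then show ?thesis using aP by blast
  qed
qed

text \<open>
  The midpoint of two orbit points at maximal distance is the centre of the orbit: by the inequality
  \<open>dist_midpoint\<close>, the midpoints of any two such pairs coincide.
\<close>

lemma finite_orbit_fixed_point:
  assumes q: "q \<in> P" and fin: "finite ((\<lambda>g. act g q) ` carrier G)"
  shows "\<exists>m\<in>P. \<forall>g\<in>carrier G. act g m = m"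
proof -
  define Om where "Om = (\<lambda>g. act g q) ` carrier G"
  have OP: "Om \<subseteq> P" using q act_P by (auto simp: Om_def)
  have Oact: "act g x \<in> Om" if g: "g \<in> carrier G" and x: "x \<in> Om" for g x
  proof -
    obtain h where "h \<in> carrier G" "x = act h q" using x unfolding Om_def by blast
    then show ?thesis using g q act_mult[of g h q] unfolding Om_def by (intro image_eqI[of _ _ "g \<otimes> h"]) simp_all
  qed
  define D where "D = (\<lambda>p. d (fst p) (snd p)) ` (Om \<times> Om)"
  have "Om \<noteq> {}" unfolding Om_def by blast
  then have D: "finite D" "D \<noteq> {}" using fin unfolding D_def Om_def[symmetric] by simp_all
  have "Max D \<in> D" using Max_in[OF D] .
  then obtain p where p: "p \<in> Om \<times> Om" "Max D = d (fst p) (snd p)" unfolding D_def by (rule imageE)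
  define x y where "x = fst p" and "y = snd p"
  have xy: "x \<in> Om" "y \<in> Om" using p(1) by (simp_all add: x_def y_def mem_Times_iff)
  have max: "d x' y' \<le> d x y" if xy': "x' \<in> Om" "y' \<in> Om" for x' y'
  proof -
    have "d x' y' \<in> D" unfolding D_def using xy' by (intro image_eqI[of _ _ "(x', y')"]) simp_all
    then show ?thesis using Max_ge[OF D(1)] p(2) by (simp add: x_def y_def)
  qed
  have P: "x \<in> P" "y \<in> P" using xy(1,2) OP by auto
  have "side x = side y" using xy(1,2) act_side q unfolding Om_def by auto
  then obtain k where k: "d x y = 2 * k" using d_even P by (metis evenE)
  then obtain m where m: "m \<in> P" "d x m = k" "d x m + d m y = 2 * k"
    using between_exists[of x y k] P by auto
  then have my: "d m y = k" by simp
  have near: "d m z \<le> k" if "z \<in> Om" for z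
    using dist_midpoint[of x y z m k] P m my k max[OF xy(1) that] max[OF xy(2) that] that OP by fastforce
  have "act g m = m" if g: "g \<in> carrier G" for g
  proof -
    have gP: "act g x \<in> P" "act g y \<in> P" "act g m \<in> P" using g P m act_P by auto
    have "d (act g m) m + k \<le> max (d (act g x) m) (d (act g y) m)"
      using dist_midpoint[of "act g x" "act g y" m "act g m" k] gP act_d g P m my k by simp
    moreover have "d (act g x) m \<le> k" "d (act g y) m \<le> k"
      using near[OF Oact[OF g]] xy(1,2) d_sym gP m by auto
    ultimately have "d (act g m) m = 0" by simp
    then show ?thesis using d_eq_0 gP m by blast
  qed
  then show ?thesis using m by blast
qed

end

section \<open>The tree of an amalgamated product\<close>

text \<open>
  Read a word as a path in the coset graph that starts at the coset of \<open>y\<close>: a letter of the first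
  factor stays at a coset of that factor, and a letter \<open>b\<close> of the second factor traverses
  the two edges represented by \<open>y\<close> and \<open>y b\<close>. If \<open>c\<close> marks a single edge, \<open>crossing\<close> is the
  parity of the number of times the path uses it.
\<close>

fun crossing :: "('a, 'm) monoid_scheme \<Rightarrow> ('a \<Rightarrow> bool) \<Rightarrow> ('a + 'a) list \<Rightarrow> 'a \<Rightarrow> bool" where
  "crossing G c [] y = False"
| "crossing G c (Inl a # w) y = crossing G c w (y \<otimes>\<^bsub>G\<^esub> a)"
| "crossing G c (Inr b # w) y = ((c y \<noteq> c (y \<otimes>\<^bsub>G\<^esub> b)) \<noteq> crossing G c w (y \<otimes>\<^bsub>G\<^esub> b))"

locale amalgam = group G for G :: "('a, 'm) monoid_scheme" (structure) +
  fixes H K :: "'a set"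
  assumes amalgam: "is_amalgamated_product_of_subgroups G H K"
begin

lemma H: "subgroup H G" and K: "subgroup K G"
  using amalgam by (auto simp: is_amalgamated_product_of_subgroups_def)

abbreviation words :: "('a + 'a) list set" where
  "words \<equiv> amalg_words (G\<lparr>carrier := H\<rparr>) (G\<lparr>carrier := K\<rparr>)"

abbreviation word_eq :: "('a + 'a) list \<Rightarrow> ('a + 'a) list \<Rightarrow> bool" where
  "word_eq \<equiv> amalg_eq (G\<lparr>carrier := H\<rparr>) (G\<lparr>carrier := K\<rparr>) (G\<lparr>carrier := H \<inter> K\<rparr>) (\<lambda>x. x) (\<lambda>x. x)"

abbreviation eval_word :: "('a + 'a) list \<Rightarrow> 'a" where
  "eval_word \<equiv> amalg_eval G (\<lambda>x. x) (\<lambda>x. x)"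

lemma H_closed: "a \<in> H \<Longrightarrow> a \<in> carrier G" and K_closed: "b \<in> K \<Longrightarrow> b \<in> carrier G"
  using subgroup.mem_carrier[OF H] subgroup.mem_carrier[OF K] by auto

lemma factor_groups: "group (G\<lparr>carrier := H\<rparr>)" "group (G\<lparr>carrier := K\<rparr>)"
  using subgroup_imp_group H K by auto

lemma inclusions: "(\<lambda>x. x) \<in> hom (G\<lparr>carrier := H\<rparr>) G" "(\<lambda>x. x) \<in> hom (G\<lparr>carrier := K\<rparr>) G"
  by (auto simp: hom_def H_closed K_closed)

lemma word_eq_words: "word_eq u v \<Longrightarrow> u \<in> words \<and> v \<in> words"
  by (rule amalg_eq_words[OF factor_groups]) auto

lemma word_eq_equiv: "equiv words {(u, v). word_eq u v}"
  by (rule amalg_eq_equiv[OF factor_groups]) auto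

lemma eval_word_closed: "w \<in> words \<Longrightarrow> eval_word w \<in> carrier G"
  using amalg_eval_closed[OF is_group, of "\<lambda>x. x" "G\<lparr>carrier := H\<rparr>" "\<lambda>x. x" "G\<lparr>carrier := K\<rparr>" w] H_closed K_closed
  by auto

lemma eval_word_append:
  "u \<in> words \<Longrightarrow> v \<in> words \<Longrightarrow> eval_word (u @ v) = eval_word u \<otimes> eval_word v"
  using amalg_eval_append[OF is_group, of "\<lambda>x. x" "G\<lparr>carrier := H\<rparr>" "\<lambda>x. x" "G\<lparr>carrier := K\<rparr>" u v] H_closed K_closed
  by auto

lemma eval_word_eq: "word_eq u v \<Longrightarrow> eval_word u = eval_word v"
  by (rule amalg_eval_eq[OF is_group factor_groups _ _ inclusions]) auto

lemma lift_class: "w \<in> words \<Longrightarrow>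
    amalg_lift G (\<lambda>x. x) (\<lambda>x. x) ({(u, v). word_eq u v} `` {w}) = eval_word w"
  by (rule amalg_lift_class[OF is_group factor_groups _ _ inclusions]) auto

lemma lift_bij:
  "bij_betw (amalg_lift G (\<lambda>x. x) (\<lambda>x. x)) (words // {(u, v). word_eq u v}) (carrier G)"
  using amalgam by (simp add: is_amalgamated_product_of_subgroups_def iso_def amalgamated_free_product_def Let_def)

lemma word_exists:
  assumes "g \<in> carrier G"
  shows "\<exists>w\<in>words. eval_word w = g"
proof -
  obtain C where C: "C \<in> words // {(u, v). word_eq u v}" "amalg_lift G (\<lambda>x. x) (\<lambda>x. x) C = g"
    using assms unfolding bij_betw_imp_surj_on[OF lift_bij, symmetric] by (rule imageE) blast
  then obtain w where "w \<in> words" "C = {(u, v). word_eq u v} `` {w}" by (blast elim: quotientE)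
  then show ?thesis using C lift_class by auto
qed

lemma word_eq_if_eval_eq:
  assumes "u \<in> words" "v \<in> words" "eval_word u = eval_word v"
  shows "word_eq u v"
proof -
  have "{(u, v). word_eq u v} `` {u} = {(u, v). word_eq u v} `` {v}"
    using lift_bij assms lift_class unfolding bij_betw_def inj_on_def
    by (metis (no_types, lifting) quotientI)
  then show ?thesis using eq_equiv_class[OF _ word_eq_equiv assms(2)] by simp
qed

lemma crossing_append:
  assumes "v \<in> words"
  shows "u \<in> words \<Longrightarrow> y \<in> carrier G \<Longrightarrow>
    crossing G c (u @ v) y = (crossing G c u y \<noteq> crossing G c v (y \<otimes> eval_word u))"
proof (induction u arbitrary: y)
  case (Cons s u)
  then have u: "u \<in> words" by (auto simp: amalg_words_def)
  show ?case
  proof (cases s)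
    case (Inl a)
    then have a: "a \<in> carrier G" using Cons H_closed by (auto simp: amalg_words_def)
    show ?thesis using Cons.IH[OF u, of "y \<otimes> a"] a Cons(3) Inl eval_word_closed[OF u] by (simp add: m_assoc)
  next
    case (Inr b)
    then have b: "b \<in> carrier G" using Cons K_closed by (auto simp: amalg_words_def)
    show ?thesis using Cons.IH[OF u, of "y \<otimes> b"] b Cons(3) Inr eval_word_closed[OF u] by (auto simp: m_assoc)
  qed
qed simp

text \<open>
  The parity is compatible with all defining relations of the amalgamated product. Invariance
  of \<open>c\<close> under the common subgroup accounts for the gluing relation.
\<close>

lemma crossing_word_eq:
  fixes c :: "'a \<Rightarrow> bool"
  assumes c: "\<And>y k. y \<in> carrier G \<Longrightarrow> k \<in> H \<Longrightarrow> k \<in> K \<Longrightarrow> c (y \<otimes> k) = c y"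
  shows "word_eq u v \<Longrightarrow> y \<in> carrier G \<Longrightarrow> crossing G c u y = crossing G c v y"
proof (induction arbitrary: y rule: amalg_eq.induct)
  case (append u u' v v')
  note w = word_eq_words[OF append(1)] word_eq_words[OF append(2)]
  have "y \<otimes> eval_word u \<in> carrier G" using append w eval_word_closed by blast
  then have "crossing G c v (y \<otimes> eval_word u) = crossing G c v' (y \<otimes> eval_word u')"
    using append.IH(2) eval_word_eq[OF append(1)] by simp
  then show ?case
    using crossing_append w append.IH(1)[OF append.prems] append.prems by simp
qed (use c in \<open>auto simp: m_assoc H_closed K_closed\<close>)

text \<open>
  Since equal products come from equivalent words, the parity depends only on the product of the
  word: this is where the free amalgamated product enters. The result is a function \<open>u\<close> on the cosets
  of the first factor which, corrected by \<open>c\<close>, is also a function on the cosets of the second.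
\<close>

lemma side_function_exists:
  fixes c :: "'a \<Rightarrow> bool"
  assumes c: "\<And>y k. y \<in> carrier G \<Longrightarrow> k \<in> H \<Longrightarrow> k \<in> K \<Longrightarrow> c (y \<otimes> k) = c y"
  shows "\<exists>u :: 'a \<Rightarrow> bool. (\<forall>g\<in>carrier G. \<forall>a\<in>H. u (g \<otimes> a) = u g) \<and>
    (\<forall>g\<in>carrier G. \<forall>b\<in>K. (u (g \<otimes> b) \<noteq> c (g \<otimes> b)) = (u g \<noteq> c g))"
proof -
  obtain w where w: "\<And>g. g \<in> carrier G \<Longrightarrow> w g \<in> words \<and> eval_word (w g) = g"
    using word_exists by metis
  define u where "u g = crossing G c (w g) \<one>" for g
  have u: "u g = crossing G c v \<one>" if "v \<in> words" "eval_word v = g" "g \<in> carrier G" for v g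
    unfolding u_def using that w by (intro crossing_word_eq[OF c] word_eq_if_eval_eq) auto
  have "u (g \<otimes> a) = u g" if "g \<in> carrier G" "a \<in> H" for g a
  proof -
    have a: "[Inl a] \<in> words" "a \<in> carrier G" using that H_closed by (auto simp: amalg_words_def)
    then have "w g @ [Inl a] \<in> words" using w that by (auto simp: amalg_words_def)
    then have "u (g \<otimes> a) = crossing G c (w g @ [Inl a]) \<one>"
      using a w that eval_word_append by (intro u) auto
    then show ?thesis using a w[OF that(1)] crossing_append by (simp add: u_def)
  qed
  moreover have "(u (g \<otimes> b) \<noteq> c (g \<otimes> b)) = (u g \<noteq> c g)" if "g \<in> carrier G" "b \<in> K" for g b
  proof -
    have b: "[Inr b] \<in> words" "b \<in> carrier G" using that K_closed by (auto simp: amalg_words_def)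
    then have "w g @ [Inr b] \<in> words" using w that by (auto simp: amalg_words_def)
    then have "u (g \<otimes> b) = crossing G c (w g @ [Inr b]) \<one>"
      using b w that eval_word_append by (intro u) auto
    then show ?thesis using b w[OF that(1)] that crossing_append by (auto simp: u_def)
  qed
  ultimately show ?thesis by blast
qed

text \<open>
  The index \<open>True\<close> stands for \<open>H\<close> and \<open>False\<close> for \<open>K\<close>. A vertex carries this index besides its coset
  because the same set may be a coset of both factors.
\<close>

definition factor :: "bool \<Rightarrow> 'a set" where "factor s = (if s then H else K)"

lemma factor_subgroup: "subgroup (factor s) G"
  using H K by (simp add: factor_def)

definition node :: "bool \<Rightarrow> 'a \<Rightarrow> bool \<times> 'a set" where
  "node s g = (s, g <#\<^bsub>G\<^esub> factor s)"

definition edges :: "(bool \<times> 'a set) rel" where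
  "edges = {(node s g, node (\<not> s) g) | s g. g \<in> carrier G}"

lemma Field_edges: "Field edges = {node s g | s g. g \<in> carrier G}"
proof -
  have "node s g \<in> Field edges" if "g \<in> carrier G" for s g
  proof (rule FieldI1)
    show "(node s g, node (\<not> s) g) \<in> edges" using that unfolding edges_def by blast
  qed
  moreover have "x \<in> {node s g | s g. g \<in> carrier G}" if "x \<in> Field edges" for x
    using that unfolding Field_def edges_def by blast
  ultimately show ?thesis by blast
qed

lemma fst_node [simp]: "fst (node s g) = s"
  by (simp add: node_def)

lemma lcos_mult: "g \<in> carrier G \<Longrightarrow> a \<in> factor s \<Longrightarrow> (g \<otimes> a) <#\<^bsub>G\<^esub> factor s = g <#\<^bsub>G\<^esub> factor s"
  using l_repr_independence[of "g \<otimes> a" g "factor s"] factor_subgroup by (auto simp: l_coset_def)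

lemma node_mult: "g \<in> carrier G \<Longrightarrow> a \<in> factor s \<Longrightarrow> node s (g \<otimes> a) = node s g"
  by (simp add: node_def lcos_mult)

lemma edge_node: "g \<in> carrier G \<Longrightarrow> (node s g, node (\<not> s) g) \<in> edges"
  unfolding edges_def by blast

lemma edge_TF: "g \<in> carrier G \<Longrightarrow> (node True g, node False g) \<in> edges"
  and edge_FT: "g \<in> carrier G \<Longrightarrow> (node False g, node True g) \<in> edges"
  using edge_node[of g True] edge_node[of g False] by simp_all

lemma edgeE:
  assumes "(x, y) \<in> edges"
  obtains s g where "g \<in> carrier G" "x = node s g" "y = node (\<not> s) g"
  using assms unfolding edges_def by blast

lemma Field_edgesE:
  assumes "x \<in> Field edges"
  obtains s g where "g \<in> carrier G" "x = node s g"
  using assms unfolding Field_edges by blast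

lemma lcos_eqD:
  assumes "g \<in> carrier G" "g' \<in> carrier G" "g <#\<^bsub>G\<^esub> factor s = g' <#\<^bsub>G\<^esub> factor s"
  shows "\<exists>a\<in>factor s. g' = g \<otimes> a"
proof -
  have "g' \<in> g' <#\<^bsub>G\<^esub> factor s"
    using subgroup.one_closed[OF factor_subgroup] assms by (force simp: l_coset_def)
  then show ?thesis using assms by (auto simp: l_coset_def)
qed

lemma word_path:
  "w \<in> words \<Longrightarrow> y \<in> carrier G \<Longrightarrow> (node True y, node True (y \<otimes> eval_word w)) \<in> edges\<^sup>*"
proof (induction w arbitrary: y)
  case (Cons s u)
  then have u: "u \<in> words" by (auto simp: amalg_words_def)
  show ?case
  proof (cases s)
    case (Inl a)
    then have a: "a \<in> factor True" "a \<in> carrier G" using Cons H_closed by (auto simp: amalg_words_def factor_def)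
    show ?thesis using Cons.IH[OF u, of "y \<otimes> a"] a Cons(3) Inl eval_word_closed[OF u] node_mult[of y a True]
      by (simp add: m_assoc)
  next
    case (Inr b)
    then have b: "b \<in> factor False" "b \<in> carrier G" using Cons K_closed by (auto simp: amalg_words_def factor_def)
    have "(node True y, node False y) \<in> edges" "(node False y, node True (y \<otimes> b)) \<in> edges"
      using edge_TF[OF Cons(3)] edge_FT[of "y \<otimes> b"] Cons(3) b node_mult[OF Cons(3) b(1)] by simp_all
    moreover have "(node True (y \<otimes> b), node True (y \<otimes> b \<otimes> eval_word u)) \<in> edges\<^sup>*"
      using Cons.IH[OF u, of "y \<otimes> b"] b Cons(3) by simp
    ultimately have "(node True y, node True (y \<otimes> b \<otimes> eval_word u)) \<in> edges\<^sup>*"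
      by (meson converse_rtrancl_into_rtrancl)
    then show ?thesis using Inr b Cons(3) eval_word_closed[OF u] by (simp add: m_assoc)
  qed
qed simp

lemma sym_edges: "sym edges"
proof (rule symI)
  fix x y assume "(x, y) \<in> edges"
  then obtain s g where "g \<in> carrier G" "x = node s g" "y = node (\<not> s) g" by (rule edgeE)
  then show "(y, x) \<in> edges" using edge_node[of g "\<not> s"] by simp
qed

lemma connected_edges:
  assumes "x \<in> Field edges" "y \<in> Field edges"
  shows "(x, y) \<in> edges\<^sup>*"
proof -
  have near: "\<exists>g\<in>carrier G. (x, node True g) \<in> edges\<^sup>*" if x: "x \<in> Field edges" for x
  proof -
    obtain s g where g: "g \<in> carrier G" "x = node s g" using x by (rule Field_edgesE)
    show ?thesis
    proof (cases s)
      case False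
      then have "(x, node True g) \<in> edges" using g edge_FT by simp
      then show ?thesis using g by blast
    qed (use g in auto)
  qed
  obtain g h where g: "g \<in> carrier G" "(x, node True g) \<in> edges\<^sup>*"
      and h: "h \<in> carrier G" "(y, node True h) \<in> edges\<^sup>*"
    using near assms by metis
  obtain w where w: "w \<in> words" "eval_word w = inv g \<otimes> h" using word_exists[of "inv g \<otimes> h"] g(1) h(1) by auto
  have "g \<otimes> eval_word w = h"
    unfolding w(2) using m_assoc[of g "inv g" h] g(1) h(1) by simp
  then have "(node True g, node True h) \<in> edges\<^sup>*"
    using word_path[OF w(1) g(1)] by simp
  moreover have "(node True h, y) \<in> edges\<^sup>*"
    using h sym_rtrancl[OF sym_edges] by (blast dest: symD)
  ultimately show ?thesis using g by (meson rtrancl_trans)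
qed

text \<open>
  For the edge represented by \<open>g\<close> let \<open>c\<close> be its characteristic function. The colouring takes the
  values of \<open>u\<close> on cosets of \<open>H\<close> and of \<open>u\<close> corrected by \<open>c\<close> on cosets of \<open>K\<close>; so the end points of the
  edge represented by \<open>h\<close> receive different colours exactly if \<open>c h\<close> holds.
\<close>

lemma wall_edges:
  assumes "(x, y) \<in> edges"
  shows "\<exists>U :: bool \<times> 'a set \<Rightarrow> bool. \<forall>a b. (a, b) \<in> edges \<longrightarrow> (U a \<noteq> U b) = ({a, b} = {x, y})"
proof -
  obtain s0 g where g: "g \<in> carrier G" and xy: "x = node s0 g" "y = node (\<not> s0) g"
    using assms by (rule edgeE)
  define c where "c h = (\<forall>s. h <#\<^bsub>G\<^esub> factor s = g <#\<^bsub>G\<^esub> factor s)" for h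
  have cinv: "c (h \<otimes> k) = c h" if "h \<in> carrier G" "k \<in> H" "k \<in> K" for h k
    using that lcos_mult[of h k] unfolding c_def by (auto simp: factor_def)
  have "\<exists>u :: 'a \<Rightarrow> bool. (\<forall>g\<in>carrier G. \<forall>a\<in>H. u (g \<otimes> a) = u g) \<and>
    (\<forall>g\<in>carrier G. \<forall>b\<in>K. (u (g \<otimes> b) \<noteq> c (g \<otimes> b)) = (u g \<noteq> c g))"
    by (rule side_function_exists) (rule cinv)
  then obtain u :: "'a \<Rightarrow> bool" where u: "(\<forall>g\<in>carrier G. \<forall>a\<in>H. u (g \<otimes> a) = u g) \<and>
    (\<forall>g\<in>carrier G. \<forall>b\<in>K. (u (g \<otimes> b) \<noteq> c (g \<otimes> b)) = (u g \<noteq> c g))" by (rule exE)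
  have uH: "u (h \<otimes> a) = u h" if "h \<in> carrier G" "a \<in> H" for h a
    using u that by simp
  have uK: "(u (h \<otimes> b) \<noteq> c (h \<otimes> b)) = (u h \<noteq> c h)" if "h \<in> carrier G" "b \<in> K" for h b
    using u that by simp
  define Q where "Q s h = (if s then u h else u h \<noteq> c h)" for s h
  define U where "U p = (\<exists>h\<in>carrier G. snd p = h <#\<^bsub>G\<^esub> factor (fst p) \<and> Q (fst p) h)" for p
  have Q: "Q s h' = Q s h" if h: "h \<in> carrier G" and h': "h' \<in> carrier G" "h <#\<^bsub>G\<^esub> factor s = h' <#\<^bsub>G\<^esub> factor s" for s h h'
  proof -
    obtain a where "a \<in> factor s" "h' = h \<otimes> a" using lcos_eqD[OF h h'] by blast
    then show ?thesis using uH[OF h, of a] uK[OF h, of a] by (cases s) (simp_all add: factor_def Q_def)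
  qed
  have U: "U (node s h) = Q s h" if h: "h \<in> carrier G" for s h
    unfolding U_def node_def fst_conv snd_conv using Q[OF h] h by blast
  have "(U a \<noteq> U b) = ({a, b} = {x, y})" if ab: "(a, b) \<in> edges" for a b
  proof -
    obtain s h where h: "h \<in> carrier G" "a = node s h" "b = node (\<not> s) h"
      using ab by (rule edgeE)
    have "(U a \<noteq> U b) = c h" unfolding h(2,3) U[OF h(1)] by (cases s) (auto simp: Q_def)
    also have "\<dots> = ({a, b} = {x, y})"
      unfolding c_def h xy node_def by (cases s; cases s0) (simp_all add: doubleton_eq_iff all_bool_eq conj_commute)
    finally show ?thesis .
  qed
  then show ?thesis by blast
qed

sublocale tree: wall_tree edges fst
proof
  show "fst x \<noteq> fst y" if "(x, y) \<in> edges" for x y using that by (rule edgeE) simp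
qed (rule sym_edges, erule (1) connected_edges, erule wall_edges)

lemma coset_action:
  assumes "group G'" "f \<in> hom G' G"
  shows "tree_action edges fst G' (\<lambda>h p. (fst p, f h <#\<^bsub>G\<^esub> snd p))"
proof -
  have f: "f h \<in> carrier G" if "h \<in> carrier G'" for h
    by (rule hom_in_carrier[OF assms(2) that])
  have fm: "f (h \<otimes>\<^bsub>G'\<^esub> k) = f h \<otimes> f k" if "h \<in> carrier G'" "k \<in> carrier G'" for h k
    by (rule hom_mult[OF assms(2) that])
  have sub: "factor s \<subseteq> carrier G" for s by (rule subgroup.subset[OF factor_subgroup])
  have m: "g <#\<^bsub>G\<^esub> (k <#\<^bsub>G\<^esub> factor s) = (g \<otimes> k) <#\<^bsub>G\<^esub> factor s" if "g \<in> carrier G" "k \<in> carrier G" for g k s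
    by (rule lcos_m_assoc[OF sub that])
  show ?thesis
  proof (intro tree_action.intro tree_action_axioms.intro)
    show "wall_tree edges fst" by (rule tree.wall_tree_axioms)
    show "group G'" by fact
  next
    fix h x y assume h: "h \<in> carrier G'" and e: "(x, y) \<in> edges"
    obtain s g where g: "g \<in> carrier G" and xy: "x = node s g" "y = node (\<not> s) g"
      using e by (rule edgeE)
    show "((fst x, f h <#\<^bsub>G\<^esub> snd x), (fst y, f h <#\<^bsub>G\<^esub> snd y)) \<in> edges"
      using edge_node[of "f h \<otimes> g" s] unfolding xy by (simp add: node_def m f h g)
  next
    fix h k x assume hk: "h \<in> carrier G'" "k \<in> carrier G'" and e: "x \<in> Field edges"
    obtain s g where g: "g \<in> carrier G" and x: "x = node s g" using e by (rule Field_edgesE)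
    show "(fst x, f (h \<otimes>\<^bsub>G'\<^esub> k) <#\<^bsub>G\<^esub> snd x) =
        (fst (fst x, f k <#\<^bsub>G\<^esub> snd x), f h <#\<^bsub>G\<^esub> snd (fst x, f k <#\<^bsub>G\<^esub> snd x))"
      by (simp add: x node_def m f fm hk g m_assoc)
  next
    fix x assume "x \<in> Field edges"
    then obtain s g where g: "g \<in> carrier G" and x: "x = node s g" by (rule Field_edgesE)
    moreover have "f \<one>\<^bsub>G'\<^esub> = \<one>" using hom_one[OF assms(2,1) is_group] .
    ultimately show "(fst x, f \<one>\<^bsub>G'\<^esub> <#\<^bsub>G\<^esub> snd x) = x" by (simp add: node_def m)
  next
    fix h x show "fst (fst x, f h <#\<^bsub>G\<^esub> snd x) = fst x" by simp
  qed
qed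

end

section \<open>Finite-dimensional normed spaces\<close>

lemma closed_if_bounded_parts_compact:
  fixes V :: "'e::real_normed_vector set"
  assumes "\<And>r. compact (cball 0 r \<inter> V)"
  shows "closed V"
  unfolding closed_sequential_limits
proof (intro allI impI)
  fix x l assume x: "(\<forall>n. x n \<in> V) \<and> x \<longlonglongrightarrow> l"
  then obtain M where "\<And>n. norm (x n) \<le> M"
    using convergent_imp_Bseq[of x] convergentI[of x l] by (auto simp: Bseq_def)
  then have "\<forall>n. x n \<in> cball 0 M \<inter> V" using x by simp
  moreover have "closed (cball 0 M \<inter> V)" using assms compact_imp_closed by blast
  ultimately show "l \<in> V" using x closed_sequentially by blast
qed

text \<open>
  Since \<open>span B\<close> is closed, \<open>b\<close> has positive distance \<open>\<delta>\<close> from it. This bounds the coefficient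
  of \<open>b\<close>, so the bounded part of the larger span is contained in a continuous image of a compact product.
\<close>

lemma compact_cball_Int_span:
  fixes B :: "'e::real_normed_vector set"
  assumes "finite B"
  shows "compact (cball 0 r \<inter> span B)"
  using assms
proof (induction B arbitrary: r rule: finite_induct)
  case empty
  have "finite (cball (0::'e) r \<inter> {0})" by simp
  then have "compact (cball (0::'e) r \<inter> {0})" by (rule finite_imp_compact)
  then show ?case by simp
next
  case (insert b B)
  show ?case
  proof (cases "b \<in> span B")
    case True
    then show ?thesis using insert.IH by (simp add: span_redundant)
  next
    case False
    have "closed (span B)" by (rule closed_if_bounded_parts_compact) (rule insert.IH)
    then have "open (- span B)" "b \<in> - span B" using False by auto
    then obtain \<delta> where \<delta>: "\<delta> > 0" and far: "ball b \<delta> \<subseteq> - span B"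
      using open_contains_ball by blast
    have coeff: "\<bar>t\<bar> * \<delta> \<le> norm (t *\<^sub>R b + v)" if v: "v \<in> span B" for t v
    proof (cases "t = 0")
      case False
      have "- ((1 / t) *\<^sub>R v) \<in> span B" using v by (intro span_neg span_scale)
      then have "- ((1 / t) *\<^sub>R v) \<notin> ball b \<delta>" using far by blast
      then have "\<delta> \<le> norm (b + (1 / t) *\<^sub>R v)" by (simp add: dist_norm)
      then have "\<bar>t\<bar> * \<delta> \<le> \<bar>t\<bar> * norm (b + (1 / t) *\<^sub>R v)" by (simp add: mult_left_mono)
      also have "\<dots> = norm (t *\<^sub>R (b + (1 / t) *\<^sub>R v))" by simp
      also have "t *\<^sub>R (b + (1 / t) *\<^sub>R v) = t *\<^sub>R b + v" using False by (simp add: scaleR_add_right)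
      finally show ?thesis .
    qed simp
    define M where "M = r + r / \<delta> * norm b"
    define K where "K = (\<lambda>(t, v). t *\<^sub>R b + v) ` ({- (r / \<delta>)..r / \<delta>} \<times> (cball 0 M \<inter> span B))"
    have "compact K"
      unfolding K_def case_prod_beta
      by (intro compact_continuous_image compact_Times insert.IH compact_Icc continuous_intros)
    moreover have "cball 0 r \<inter> span (insert b B) = cball 0 r \<inter> K"
    proof
      have "t *\<^sub>R b + v \<in> span (insert b B)" if "v \<in> span B" for t v
        using that span_mono[of B "insert b B"] by (intro span_add span_scale) (auto intro: span_base)
      then show "cball 0 r \<inter> K \<subseteq> cball 0 r \<inter> span (insert b B)"
        by (auto simp: K_def)
      show "cball 0 r \<inter> span (insert b B) \<subseteq> cball 0 r \<inter> K"
      proof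
        fix x assume x: "x \<in> cball 0 r \<inter> span (insert b B)"
        then obtain t where t: "x - t *\<^sub>R b \<in> span B" by (auto simp: span_breakdown_eq)
        define v where "v = x - t *\<^sub>R b"
        have v: "v \<in> span B" "x = t *\<^sub>R b + v" "norm x \<le> r" using t x by (auto simp: v_def)
        then have "\<bar>t\<bar> * \<delta> \<le> r" using coeff[OF v(1), of t] by simp
        then have tr: "\<bar>t\<bar> \<le> r / \<delta>" using \<delta> by (simp add: pos_le_divide_eq)
        have "norm v \<le> norm x + norm (t *\<^sub>R b)" unfolding v_def by (rule norm_triangle_ineq4)
        also have "\<dots> \<le> M" unfolding M_def using v(3) mult_right_mono[OF tr norm_ge_zero[of b]] by simp
        finally have "(t, v) \<in> {- (r / \<delta>)..r / \<delta>} \<times> (cball 0 M \<inter> span B)" using tr v(1) by (auto simp: abs_le_iff)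
        then have "x \<in> K" unfolding K_def v(2) by (intro image_eqI[of _ _ "(t, v)"]) simp_all
        then show "x \<in> cball 0 r \<inter> K" using x by simp
      qed
    qed
    ultimately show ?thesis by (simp add: closed_Int_compact)
  qed
qed

lemma compact_cball_if_finite_span:
  fixes B :: "'e::real_normed_vector set"
  assumes "finite B" "span B = UNIV"
  shows "compact (cball (x :: 'e) r)"
proof -
  have "compact ((+) x ` cball 0 r)"
    using compact_cball_Int_span[OF assms(1), of r] assms(2) by (intro compact_translation) simp
  then show ?thesis by (simp add: cball_translation[symmetric])
qed

text \<open>
  Every unit vector is within \<open>1/2\<close> of the net \<open>N\<close>, which gives \<open>onorm A \<le> \<epsilon> + onorm A / 2\<close>.
\<close>

lemma onorm_le_net:
  fixes A :: "'e::real_normed_vector \<Rightarrow> 'f::real_normed_vector"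
  assumes A: "bounded_linear A" and N: "cball 0 1 \<subseteq> (\<Union>n\<in>N. ball n (1/2))"
    and le: "\<And>n. n \<in> N \<Longrightarrow> norm (A n) \<le> \<epsilon>"
  shows "onorm A \<le> 2 * \<epsilon>"
proof -
  interpret A: bounded_linear A by fact
  obtain n\<^sub>0 where "n\<^sub>0 \<in> N" using N by fastforce
  then have "0 \<le> \<epsilon>" using le norm_ge_zero order_trans by blast
  have "onorm A \<le> \<epsilon> + onorm A / 2"
  proof (rule onorm_bound)
    show "0 \<le> \<epsilon> + onorm A / 2" using \<open>0 \<le> \<epsilon>\<close> onorm_pos_le[OF A] by simp
    fix x
    show "norm (A x) \<le> (\<epsilon> + onorm A / 2) * norm x"
    proof (cases "x = 0")
      case True
      then show ?thesis by (simp add: A.zero)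
    next
      case False
      define v where "v = (1 / norm x) *\<^sub>R x"
      have "v \<in> cball 0 1" using False by (simp add: v_def)
      then obtain n where n: "n \<in> N" "norm (v - n) \<le> 1/2"
        using N by (auto simp: dist_norm norm_minus_commute intro: less_imp_le)
      have "norm (A v) = norm (A n + A (v - n))" by (simp add: A.diff)
      also have "\<dots> \<le> norm (A n) + norm (A (v - n))" by (rule norm_triangle_ineq)
      also have "norm (A (v - n)) \<le> onorm A * norm (v - n)" by (rule onorm[OF A])
      also have "\<dots> \<le> onorm A * (1/2)" using n(2) onorm_pos_le[OF A] by (rule mult_left_mono)
      finally have "norm (A v) \<le> \<epsilon> + onorm A / 2" using le[OF n(1)] by simp
      then have "norm (A v) * norm x \<le> (\<epsilon> + onorm A / 2) * norm x" by (rule mult_right_mono) simp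
      then show ?thesis using False by (simp add: v_def A.scaleR)
    qed
  qed
  then show ?thesis by simp
qed

text \<open>
  As the unit ball is compact, pointwise convergence of linear maps is convergence in
  operator norm.
\<close>

lemma onorm_eventually_small:
  fixes D :: "'e::real_normed_vector \<Rightarrow> 'e \<Rightarrow> 'f::real_normed_vector"
  assumes cpt: "compact (cball (0::'e) 1)" and "open S" "x\<^sub>0 \<in> S"
    and D: "\<And>x. x \<in> S \<Longrightarrow> bounded_linear (D x)"
    and cont: "\<And>v. isCont (\<lambda>x. D x v) x\<^sub>0" "\<And>v. D x\<^sub>0 v = 0" and "\<epsilon> > 0"
  shows "\<exists>R>0. cball x\<^sub>0 R \<subseteq> S \<and> (\<forall>x\<in>cball x\<^sub>0 R. onorm (D x) \<le> \<epsilon>)"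
proof -
  obtain N where N: "finite N" "cball (0::'e) 1 \<subseteq> (\<Union>n\<in>N. ball n (1/2))"
    using cpt unfolding compact_eq_totally_bounded by (metis half_gt_zero_iff zero_less_one)
  have "\<forall>\<^sub>F x in nhds x\<^sub>0. norm (D x v) < \<epsilon> / 2" for v
  proof -
    have "((\<lambda>x. D x v) \<longlongrightarrow> 0) (nhds x\<^sub>0)"
      using tendsto_at_iff_tendsto_nhds[of "\<lambda>x. D x v" x\<^sub>0] cont(1)[of v] cont(2)[of v]
      by (simp add: continuous_at)
    then have "\<forall>\<^sub>F x in nhds x\<^sub>0. dist (D x v) 0 < \<epsilon> / 2"
      using \<open>\<epsilon> > 0\<close> by (intro tendstoD) auto
    then show ?thesis by simp
  qed
  then have "\<forall>\<^sub>F x in nhds x\<^sub>0. \<forall>v\<in>N. norm (D x v) < \<epsilon> / 2"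
    using N(1) by (simp add: eventually_ball_finite)
  moreover have "\<forall>\<^sub>F x in nhds x\<^sub>0. x \<in> S" using assms(2,3) eventually_nhds by blast
  ultimately have "\<forall>\<^sub>F x in nhds x\<^sub>0. x \<in> S \<and> (\<forall>v\<in>N. norm (D x v) < \<epsilon> / 2)"
    by eventually_elim simp
  then obtain d where d: "d > 0" "\<And>x. dist x x\<^sub>0 < d \<Longrightarrow> x \<in> S \<and> (\<forall>v\<in>N. norm (D x v) < \<epsilon> / 2)"
    unfolding eventually_nhds_metric by blast
  have "x \<in> S \<and> onorm (D x) \<le> \<epsilon>" if "x \<in> cball x\<^sub>0 (d / 2)" for x
  proof -
    have "dist x x\<^sub>0 < d" using that d(1) by (simp add: dist_commute)
    note x = d(2)[OF this]
    then have "onorm (D x) \<le> 2 * (\<epsilon> / 2)"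
      using D N(2) by (intro onorm_le_net[of _ N]) (auto intro: less_imp_le)
    then show ?thesis using x by simp
  qed
  then show ?thesis using d(1) by (intro exI[of _ "d / 2"]) auto
qed

text \<open>
  The part of the inverse function theorem that yields square roots. A solution of \<open>s x = y\<close> is
  a fixed point of \<open>x - s x / 2 + y / 2\<close>. As \<open>x - s x / 2\<close> has derivative zero at \<open>x\<^sub>0\<close>, this is a
  contraction near \<open>x\<^sub>0\<close>, and the constant \<open>1/4\<close> is small enough to keep the solution in the
  very same ball that contains \<open>y\<close>. This allows the choice of roots to be iterated.
\<close>

lemma locally_doubling_map_onto:
  fixes s :: "'e::real_normed_vector \<Rightarrow> 'e"
  assumes cpt: "\<And>r. compact (cball (x\<^sub>0::'e) r)" "compact (cball (0::'e) 1)"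
    and S: "open S" "x\<^sub>0 \<in> S" and fix0: "s x\<^sub>0 = x\<^sub>0"
    and der: "\<And>x. x \<in> S \<Longrightarrow> (s has_derivative s' x) (at x)"
    and cont: "\<And>v. isCont (\<lambda>x. s' x v) x\<^sub>0" and dbl: "\<And>v. s' x\<^sub>0 v = 2 *\<^sub>R v"
  shows "\<exists>R>0. ball x\<^sub>0 R \<subseteq> S \<and> (\<forall>y\<in>ball x\<^sub>0 R. \<exists>x\<in>ball x\<^sub>0 R. s x = y)"
proof -
  define D where "D x v = v - (1/2) *\<^sub>R s' x v" for x v
  define k where "k x = x - (1/2) *\<^sub>R s x" for x
  have derk: "(k has_derivative D x) (at x)" if "x \<in> S" for x
    unfolding k_def D_def using der[OF that] by (auto intro!: derivative_eq_intros)
  have contD: "isCont (\<lambda>x. D x v) x\<^sub>0" for v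
    unfolding D_def using cont[of v] by (intro continuous_intros)
  have "\<exists>R>0. cball x\<^sub>0 R \<subseteq> S \<and> (\<forall>x\<in>cball x\<^sub>0 R. onorm (D x) \<le> 1/4)"
  proof (rule onorm_eventually_small[OF cpt(2) S])
    show "bounded_linear (D x)" if "x \<in> S" for x using derk[OF that] by (rule has_derivative_bounded_linear)
    show "isCont (\<lambda>x. D x v) x\<^sub>0" for v by (rule contD)
  qed (auto simp: D_def dbl)
  then obtain R where R: "R > 0" "cball x\<^sub>0 R \<subseteq> S" and small: "\<And>x. x \<in> cball x\<^sub>0 R \<Longrightarrow> onorm (D x) \<le> 1/4"
    by blast
  have lip: "norm (k x - k y) \<le> 1/4 * norm (x - y)" if "x \<in> cball x\<^sub>0 R" "y \<in> cball x\<^sub>0 R" for x y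
    using differentiable_bound[of "cball x\<^sub>0 R" k D "1/4" x y] small that R(2) derk has_derivative_at_withinI by blast
  have "\<exists>x\<in>ball x\<^sub>0 R. s x = y" if y: "y \<in> ball x\<^sub>0 R" for y
  proof -
    \<comment> \<open>Newton iteration with the fixed approximate derivative \<open>2\<close>.\<close>
    define T where "T x = k x + (1/2) *\<^sub>R y" for x
    have T0: "norm (T x - x\<^sub>0) \<le> 1/4 * norm (x - x\<^sub>0) + 1/2 * norm (y - x\<^sub>0)" if "x \<in> cball x\<^sub>0 R" for x
    proof -
      have "T x - x\<^sub>0 = (k x - k x\<^sub>0) + (1/2) *\<^sub>R (y - x\<^sub>0)"
        unfolding T_def k_def fix0 by (simp add: algebra_simps flip: scaleR_add_left)
      then have "norm (T x - x\<^sub>0) \<le> norm (k x - k x\<^sub>0) + norm ((1/2) *\<^sub>R (y - x\<^sub>0))"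
        using norm_triangle_ineq[of "k x - k x\<^sub>0" "(1/2) *\<^sub>R (y - x\<^sub>0)"] by simp
      then show ?thesis using lip[OF that, of x\<^sub>0] R(1) by simp
    qed
    have yR: "norm (y - x\<^sub>0) < R" using y by (simp add: dist_norm norm_minus_commute)
    have "\<exists>!x\<in>cball x\<^sub>0 R. T x = x"
    proof (rule Banach_fix[of _ "1/4"])
      show "complete (cball x\<^sub>0 R)" using cpt(1) compact_imp_complete by blast
      show "cball x\<^sub>0 R \<noteq> {}" using R(1) by simp
      show "T ` cball x\<^sub>0 R \<subseteq> cball x\<^sub>0 R"
      proof
        fix z assume "z \<in> T ` cball x\<^sub>0 R"
        then obtain x where x: "x \<in> cball x\<^sub>0 R" "z = T x" by blast
        then have "norm (x - x\<^sub>0) \<le> R" by (simp add: dist_norm norm_minus_commute)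
        then have "norm (z - x\<^sub>0) \<le> R" using T0[OF x(1)] yR norm_ge_zero[of "y - x\<^sub>0"] unfolding x(2) by linarith
        then show "z \<in> cball x\<^sub>0 R" by (simp add: dist_norm norm_minus_commute)
      qed
      show "dist (T x) (T y) \<le> 1/4 * dist x y" if "x \<in> cball x\<^sub>0 R" "y \<in> cball x\<^sub>0 R" for x y
        using lip[OF that] by (simp add: T_def dist_norm)
    qed auto
    then obtain x where x: "x \<in> cball x\<^sub>0 R" "T x = x" by blast
    have "norm (x - x\<^sub>0) < R" using T0[OF x(1)] yR norm_ge_zero[of "y - x\<^sub>0"] unfolding x(2) by linarith
    moreover have "(1/2) *\<^sub>R s x = (1/2) *\<^sub>R y" using x(2) by (simp add: T_def k_def)
    ultimately show ?thesis by (intro bexI[of _ x]) (auto simp: dist_norm norm_minus_commute)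
  qed
  moreover have "ball x\<^sub>0 R \<subseteq> S" using R(2) ball_subset_cball by blast
  ultimately show ?thesis using R(1) by blast
qed

section \<open>Lie groups near the identity\<close>

lemma chart_image_open:
  assumes "is_chart T (U, f)" "V \<subseteq> U" "openin T V"
  shows "open (f ` V)"
proof -
  have U: "openin T U" "open (f ` U)"
    and hom: "homeomorphic_map (subtopology T U) (top_of_set (f ` U)) f"
    using assms(1) by (auto simp: is_chart_def)
  have top: "V \<subseteq> topspace (subtopology T U)"
    using assms(2) openin_subset[OF U(1)] by (simp add: topspace_subtopology_subset)
  have "openin (subtopology T U) V"
    using assms U openin_open_subtopology by blast
  then have "openin (top_of_set (f ` U)) (f ` V)"
    using homeomorphic_map_openness[OF hom top] by simp
  then show ?thesis using openin_open_eq[OF U(2)] by blast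
qed

lemma chart_preimage_open:
  assumes "is_chart T (U, f)" "open S"
  shows "openin T {x \<in> U. f x \<in> S}"
proof -
  have U: "openin T U" and hom: "homeomorphic_map (subtopology T U) (top_of_set (f ` U)) f"
    using assms(1) by (auto simp: is_chart_def)
  have top: "topspace (subtopology T U) = U"
    using openin_subset[OF U] by (rule topspace_subtopology_subset)
  have "openin (subtopology T U) {x \<in> topspace (subtopology T U). f x \<in> f ` U \<inter> S}"
    using homeomorphic_imp_continuous_map[OF hom] openin_open_Int[OF assms(2)]
    by (rule openin_continuous_map_preimage)
  moreover have "{x \<in> topspace (subtopology T U). f x \<in> f ` U \<inter> S} = {x \<in> U. f x \<in> S}"
    unfolding top by auto
  ultimately show ?thesis using openin_open_subtopology[OF U] by simp
qed

lemma chart_inj: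
  assumes "is_chart T (U, f)"
  shows "inj_on f U"
proof -
  have U: "openin T U" and hom: "homeomorphic_map (subtopology T U) (top_of_set (f ` U)) f"
    using assms(1) by (auto simp: is_chart_def)
  have "topspace (subtopology T U) = U"
    using openin_subset[OF U] by (rule topspace_subtopology_subset)
  then show ?thesis using homeomorphic_imp_injective_map[OF hom] by simp
qed

lemma manifold_locally_compact:
  fixes \<A> :: "('a, 'e::real_normed_vector) chart set"
  assumes "smooth_manifold T \<A>"
  shows "locally_compact_space T"
  unfolding locally_compact_space_def
proof
  fix x assume x: "x \<in> topspace T"
  obtain B :: "'e set" where B: "finite B" "span B = UNIV"
    using assms by (auto simp: smooth_manifold_def)
  have "x \<in> (\<Union>(U, f)\<in>\<A>. U)" using assms x by (simp add: smooth_manifold_def)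
  then obtain U f where Uf: "(U, f) \<in> \<A>" "x \<in> U" by auto
  then have c: "is_chart T (U, f)" using assms by (auto simp: smooth_manifold_def)
  then have U: "openin T U" "open (f ` U)"
    and hom: "homeomorphic_map (subtopology T U) (top_of_set (f ` U)) f"
    by (auto simp: is_chart_def)
  have top: "topspace (subtopology T U) = U"
    using openin_subset[OF U(1)] by (rule topspace_subtopology_subset)
  obtain r where r: "r > 0" "cball (f x) r \<subseteq> f ` U"
    using U(2) Uf(2) open_contains_cball by (meson imageI)
  let ?O = "{y \<in> U. f y \<in> ball (f x) r}" and ?K = "{y \<in> U. f y \<in> cball (f x) r}"
  have "f ` ?K = cball (f x) r" using r(2) by auto
  moreover have "compactin (top_of_set (f ` U)) (cball (f x) r)"
    using r(2) compact_cball_if_finite_span[OF B] by (simp add: compactin_subtopology)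
  ultimately have "compactin (subtopology T U) ?K"
    using homeomorphic_map_compactness[OF hom, of ?K] top by auto
  then have "compactin T ?K" by (simp add: compactin_subtopology)
  moreover have "openin T ?O" using chart_preimage_open[OF c] by blast
  moreover have "x \<in> ?O" "?O \<subseteq> ?K" using Uf(2) r(1) by auto
  ultimately show "\<exists>Q K. openin T Q \<and> compactin T K \<and> x \<in> Q \<and> Q \<subseteq> K" by blast
qed

lemma lie_group_mult_continuous:
  assumes "lie_group G T \<A>"
  shows "continuous_map (prod_topology T T) T (\<lambda>(x, y). x \<otimes>\<^bsub>G\<^esub> y)"
  using assms by (auto simp: lie_group_def smooth_map_def)

lemma lie_group_small_products:
  assumes lie: "lie_group G T \<A>" and W: "openin T W" "\<one>\<^bsub>G\<^esub> \<in> W"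
  shows "\<exists>V. openin T V \<and> \<one>\<^bsub>G\<^esub> \<in> V \<and> V \<subseteq> W \<and> (\<forall>x\<in>V. \<forall>y\<in>V. x \<otimes>\<^bsub>G\<^esub> y \<in> W)"
proof -
  let ?M = "{z \<in> topspace (prod_topology T T). (case z of (x, y) \<Rightarrow> x \<otimes>\<^bsub>G\<^esub> y) \<in> W}"
  interpret group G using lie by (simp add: lie_group_def)
  have top: "topspace T = carrier G" using lie by (simp add: lie_group_def)
  have "openin (prod_topology T T) ?M"
    using lie_group_mult_continuous[OF lie] W(1) by (rule openin_continuous_map_preimage)
  moreover have "(\<one>\<^bsub>G\<^esub>, \<one>\<^bsub>G\<^esub>) \<in> ?M" using W(2) by (simp add: top)
  ultimately obtain V1 V2 where V: "openin T V1" "openin T V2" "\<one>\<^bsub>G\<^esub> \<in> V1" "\<one>\<^bsub>G\<^esub> \<in> V2" "V1 \<times> V2 \<subseteq> ?M"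
    unfolding openin_prod_topology_alt by meson
  have "x \<otimes>\<^bsub>G\<^esub> y \<in> W" if "x \<in> V1" "y \<in> V2" for x y
  proof -
    have "(x, y) \<in> ?M" using V(5) that by blast
    then show ?thesis by simp
  qed
  then show ?thesis using V W by (intro exI[of _ "V1 \<inter> V2 \<inter> W"]) (simp add: openin_Int)
qed

text \<open>
  In a chart around the identity, multiplication has the derivative \<open>(v, w) \<mapsto> v + w\<close> at the identity, so
  squaring has derivative \<open>v \<mapsto> 2 v\<close> there and \<open>locally_doubling_map_onto\<close> applies. The roots lie in
  the same neighbourhood, hence have roots themselves. The argument replaces the exponential map.
\<close>

lemma lie_group_square_roots:
  fixes \<A> :: "('g, 'e::real_normed_vector) chart set"
  assumes lie: "lie_group G T \<A>"
  shows "\<exists>W. openin T W \<and> \<one>\<^bsub>G\<^esub> \<in> W \<and> (\<forall>w\<in>W. \<exists>h\<in>W. h \<otimes>\<^bsub>G\<^esub> h = w)"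
proof -
  interpret group G using lie by (simp add: lie_group_def)
  have top: "topspace T = carrier G" and man: "smooth_manifold T \<A>"
    and smooth: "smooth_map (prod_topology T T) (prod_atlas \<A> \<A>) T \<A> (\<lambda>(x, y). x \<otimes>\<^bsub>G\<^esub> y)"
    using lie by (auto simp: lie_group_def)
  obtain B :: "'e set" where B: "finite B" "span B = UNIV"
    using man by (auto simp: smooth_manifold_def)
  have "\<one>\<^bsub>G\<^esub> \<in> (\<Union>(U, f)\<in>\<A>. U)" using man top by (simp add: smooth_manifold_def)
  then obtain U f where Uf: "(U, f) \<in> \<A>" "\<one>\<^bsub>G\<^esub> \<in> U" by auto
  then have c: "is_chart T (U, f)" using man by (auto simp: smooth_manifold_def)
  then have U: "openin T U" by (simp add: is_chart_def)
  have inj: "inj_on f U" using chart_inj[OF c] .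
  obtain N where N: "openin T N" "\<one>\<^bsub>G\<^esub> \<in> N" "N \<subseteq> U" "\<And>x y. x \<in> N \<Longrightarrow> y \<in> N \<Longrightarrow> x \<otimes>\<^bsub>G\<^esub> y \<in> U"
    using lie_group_small_products[OF lie U Uf(2)] by blast
  have NG: "N \<subseteq> carrier G" using openin_subset[OF N(1)] top by simp
  define F where "F = f \<circ> (\<lambda>(x, y). x \<otimes>\<^bsub>G\<^esub> y) \<circ> inv_into (U \<times> U) (map_prod f f)"
  define \<Omega> where "\<Omega> = map_prod f f ` {z \<in> U \<times> U. (case z of (x, y) \<Rightarrow> x \<otimes>\<^bsub>G\<^esub> y) \<in> U}"
  have injp: "inj_on (map_prod f f) (U \<times> U)" using inj by (auto simp: inj_on_def)
  have F: "F (f x, f y) = f (x \<otimes>\<^bsub>G\<^esub> y)" if "x \<in> N" "y \<in> N" for x y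
  proof -
    have "inv_into (U \<times> U) (map_prod f f) (map_prod f f (x, y)) = (x, y)"
      using inv_into_f_f[OF injp, of "(x, y)"] that N(3) by blast
    then show ?thesis by (simp add: F_def)
  qed
  have sub: "(f x, f y) \<in> \<Omega>" if "x \<in> N" "y \<in> N" for x y
    unfolding \<Omega>_def using that N(3,4) by (intro image_eqI[of _ _ "(x, y)"]) auto
  have "(U \<times> U, map_prod f f) \<in> prod_atlas \<A> \<A>" using Uf(1) by (auto simp: prod_atlas_def)
  then have sm: "smooth_on \<Omega> F"
    using smooth Uf(1) unfolding smooth_map_def F_def \<Omega>_def by fast
  then have td: "times_differentiable_on (Suc (Suc 0)) \<Omega> F" unfolding smooth_on_def by blast
  define DF where "DF p = frechet_derivative F (at p)" for p
  have dF: "(F has_derivative DF p) (at p)" if "p \<in> \<Omega>" for p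
    using td that unfolding DF_def by (simp add: frechet_derivative_works)
  have contF: "isCont (\<lambda>p. DF p v) p" if "p \<in> \<Omega>" for p v
  proof -
    have "(\<lambda>p. DF p v) differentiable (at p)"
      using td that unfolding DF_def times_differentiable_on.simps by blast
    then show ?thesis by (rule differentiable_imp_continuous_within)
  qed
  define e where "e = f \<one>\<^bsub>G\<^esub>"
  define S where "S = f ` N"
  have S: "open S" "e \<in> S" using chart_image_open[OF c N(3,1)] N(2) by (auto simp: S_def e_def)
  have SS: "(x, y) \<in> \<Omega>" if "x \<in> S" "y \<in> S" for x y using that sub by (auto simp: S_def)
  have Fe1: "F (x, e) = x" and Fe2: "F (e, x) = x" if "x \<in> S" for x
    using that F N(2) NG by (auto simp: S_def e_def subset_iff)
  have d1: "DF (e, e) (v, 0) = v" for v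
  proof -
    have "((\<lambda>x. F (x, e)) has_derivative (\<lambda>v. DF (e, e) (v, 0))) (at e)"
      using dF[OF SS[OF S(2,2)]] by (rule has_derivative_compose[rotated]) (auto intro!: derivative_eq_intros)
    then have "((\<lambda>x. x) has_derivative (\<lambda>v. DF (e, e) (v, 0))) (at e)"
      by (rule has_derivative_transform_within_open[OF _ S]) (simp add: Fe1)
    then have "(\<lambda>v. DF (e, e) (v, 0)) = (\<lambda>v. v)"
      using has_derivative_ident by (rule has_derivative_unique)
    then show ?thesis by metis
  qed
  have d2: "DF (e, e) (0, v) = v" for v
  proof -
    have "((\<lambda>x. F (e, x)) has_derivative (\<lambda>v. DF (e, e) (0, v))) (at e)"
      using dF[OF SS[OF S(2,2)]] by (rule has_derivative_compose[rotated]) (auto intro!: derivative_eq_intros)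
    then have "((\<lambda>x. x) has_derivative (\<lambda>v. DF (e, e) (0, v))) (at e)"
      by (rule has_derivative_transform_within_open[OF _ S]) (simp add: Fe2)
    then have "(\<lambda>v. DF (e, e) (0, v)) = (\<lambda>v. v)"
      using has_derivative_ident by (rule has_derivative_unique)
    then show ?thesis by metis
  qed
  have "\<exists>R>0. ball e R \<subseteq> S \<and> (\<forall>y\<in>ball e R. \<exists>x\<in>ball e R. F (x, x) = y)"
  proof (rule locally_doubling_map_onto[where s' = "\<lambda>x v. DF (x, x) (v, v)"])
    show "compact (cball e r)" "compact (cball (0::'e) 1)" for r
      using compact_cball_if_finite_span[OF B] by auto
    show "((\<lambda>x. F (x, x)) has_derivative (\<lambda>v. DF (x, x) (v, v))) (at x)" if "x \<in> S" for x
      using dF[OF SS[OF that that]] by (rule has_derivative_compose[rotated]) (auto intro!: derivative_eq_intros)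
    show "isCont (\<lambda>x. DF (x, x) (v, v)) e" for v
      using isCont_o2[of e "\<lambda>x. (x, x)" "\<lambda>p. DF p (v, v)"] contF[OF SS[OF S(2,2)]]
      by (simp add: continuous_intros)
    show "DF (e, e) (v, v) = 2 *\<^sub>R v" for v
    proof -
      interpret D: bounded_linear "DF (e, e)" using dF[OF SS[OF S(2,2)]] by (rule has_derivative_bounded_linear)
      have "DF (e, e) (v, v) = DF (e, e) (v, 0) + DF (e, e) (0, v)" by (simp flip: D.add)
      then show ?thesis by (simp add: d1 d2 scaleR_2)
    qed
    show "F (e, e) = e" using Fe1 S(2) .
  qed (use S in auto)
  then obtain R where R: "R > 0" "ball e R \<subseteq> S" and roots: "\<And>y. y \<in> ball e R \<Longrightarrow> \<exists>x\<in>ball e R. F (x, x) = y"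
    by blast
  let ?W = "{x \<in> U. f x \<in> ball e R}"
  have "\<exists>h\<in>?W. h \<otimes>\<^bsub>G\<^esub> h = w" if w: "w \<in> ?W" for w
  proof -
    obtain x where x: "x \<in> ball e R" "F (x, x) = f w" using roots w by blast
    then obtain h where h: "h \<in> N" "x = f h" using R(2) by (auto simp: S_def)
    then have "f (h \<otimes>\<^bsub>G\<^esub> h) = f w" using x F by simp
    then have "h \<otimes>\<^bsub>G\<^esub> h = w" using inj N(4) h(1) w by (auto dest: inj_onD)
    then show ?thesis using h x(1) N(3) by auto
  qed
  moreover have "openin T ?W" using chart_preimage_open[OF c] by blast
  moreover have "\<one>\<^bsub>G\<^esub> \<in> ?W" using Uf(2) R(1) by (simp add: e_def)
  ultimately show ?thesis by blast
qed

section \<open>Continuous homomorphisms into amalgamated products\<close>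

lemma left_translation_continuous:
  assumes "group G" and cont: "continuous_map (prod_topology T T) T (\<lambda>(x, y). x \<otimes>\<^bsub>G\<^esub> y)"
    and top: "topspace T = carrier G" and g: "g \<in> carrier G"
  shows "continuous_map T T (\<lambda>x. g \<otimes>\<^bsub>G\<^esub> x)"
proof -
  have "continuous_map T (prod_topology T T) (\<lambda>x. (g, x))"
    using g top by (simp add: continuous_map_pairedI)
  from continuous_map_compose[OF this cont] show ?thesis by (simp add: o_def)
qed

text \<open>
  A closed stabiliser containing an open set is a clopen subgroup. Its cosets are clopen, so
  each connected component lies in one of them and moves \<open>p\<close> to a single point.
\<close>

lemma (in tree_action) finite_orbit_if_open_stabilizer:
  assumes cont: "continuous_map (prod_topology T T) T (\<lambda>(x, y). x \<otimes> y)"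
    and top: "topspace T = carrier G" and fin: "finite (connected_components_of T)"
    and p: "p \<in> P" and closed: "closedin T {g \<in> carrier G. act g p = p}"
    and N: "openin T N" "N \<noteq> {}" "N \<subseteq> {g \<in> carrier G. act g p = p}"
  shows "finite ((\<lambda>g. act g p) ` carrier G)"
proof -
  let ?S = "{g \<in> carrier G. act g p = p}"
  note trans = left_translation_continuous[OF is_group cont top]
  have "openin T ?S"
  proof (subst openin_subopen, intro ballI)
    fix h assume h: "h \<in> ?S"
    obtain n where n: "n \<in> N" using N(2) by blast
    then have nS: "n \<in> carrier G" "act n p = p" using N(3) by auto
    have c: "n \<otimes> inv h \<in> carrier G" using h nS by simp
    \<comment> \<open>The translate of \<open>N\<close> that moves its point \<open>n\<close> to \<open>h\<close>.\<close>
    let ?M = "{x \<in> topspace T. (n \<otimes> inv h) \<otimes> x \<in> N}"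
    have "openin T ?M" using trans[OF c] N(1) by (rule openin_continuous_map_preimage)
    moreover have "h \<in> ?M" using h n nS by (simp add: top m_assoc)
    moreover have "?M \<subseteq> ?S"
    proof
      fix x assume x: "x \<in> ?M"
      then have xG: "x \<in> carrier G" using top by simp
      have "act (inv h) p = p" using h act_inv[of h p] p by simp
      moreover have "act ((n \<otimes> inv h) \<otimes> x) p = p" using x N(3) by blast
      ultimately have "act (n \<otimes> inv h) (act x p) = act (n \<otimes> inv h) p"
        using xG c h nS p act_mult by simp
      then have "act x p = p" using act_inv[OF c] act_P[OF xG p] p by metis
      then show "x \<in> ?S" using xG by simp
    qed
    ultimately show "\<exists>M. openin T M \<and> h \<in> M \<and> M \<subseteq> ?S" by blast
  qed
  have const: "act x p = act g p" if C: "C \<in> connected_components_of T" and g: "g \<in> C" and x: "x \<in> C" for C g x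
  proof -
    have CG: "C \<subseteq> carrier G" using connectedin_subset_topspace[OF connectedin_connected_components_of[OF C]] top by simp
    have gG: "inv g \<in> carrier G" "g \<in> carrier G" and xG: "x \<in> carrier G" using CG g x by auto
    let ?M = "{y \<in> topspace T. inv g \<otimes> y \<in> ?S}"
    have "openin T ?M" using trans[OF gG(1)] \<open>openin T ?S\<close> by (rule openin_continuous_map_preimage)
    moreover have "closedin T ?M" using trans[OF gG(1)] closed by (rule closedin_continuous_map_preimage)
    ultimately have "C \<subseteq> ?M \<or> disjnt C ?M"
      using connectedin_clopen_cases[OF connectedin_connected_components_of[OF C]] by blast
    moreover have "g \<in> ?M" using gG act_one p by (simp add: top)
    ultimately have "x \<in> ?M" using g x unfolding disjnt_iff by blast
    then have "act (inv g) (act x p) = p" using act_mult[OF gG(1) xG p] by simp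
    then have "act g (act (inv g) (act x p)) = act g p" by simp
    then show ?thesis using act_inv[OF gG(1) act_P[OF xG p]] gG by simp
  qed
  have "(\<lambda>g. act g p) ` carrier G \<subseteq> (\<lambda>C. act (SOME g. g \<in> C) p) ` connected_components_of T"
  proof
    fix q assume "q \<in> (\<lambda>g. act g p) ` carrier G"
    then obtain g where g: "g \<in> carrier G" "q = act g p" by blast
    then obtain C where C: "C \<in> connected_components_of T" "g \<in> C"
      using Union_connected_components_of[of T] top by blast
    have some: "(SOME g. g \<in> C) \<in> C" using C(2) by (rule someI)
    show "q \<in> (\<lambda>C. act (SOME g. g \<in> C) p) ` connected_components_of T"
      using const[OF C(1) some C(2)] g(2) C(1) by (intro image_eqI[of _ _ C]) simp_all
  qed
  then show ?thesis using fin finite_surj by blast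
qed

text \<open>
  The elements fixing all \<open>a n\<close> with \<open>n \<ge> N\<close> form a closed set, and these countably many closed sets
  cover \<open>V\<close>. By Baire's theorem one of them has an interior point, which makes the stabiliser of \<open>a N\<close> open.
\<close>

lemma (in tree_action) fixed_point_if_locally_elliptic:
  assumes cont: "continuous_map (prod_topology T T) T (\<lambda>(x, y). x \<otimes> y)"
    and top: "topspace T = carrier G" and fin: "finite (connected_components_of T)"
    and lc: "locally_compact_space T" "Hausdorff_space T"
    and p: "p \<in> P" and closed: "\<And>x. x \<in> P \<Longrightarrow> closedin T {g \<in> carrier G. act g x = x}"
    and V: "openin T V" "V \<noteq> {}" "\<And>g. g \<in> V \<Longrightarrow> elliptic g"
      "\<And>g h. g \<in> V \<Longrightarrow> h \<in> V \<Longrightarrow> elliptic (g \<otimes> h)"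
  shows "\<exists>x\<in>P. \<forall>g\<in>carrier G. act g x = x"
proof -
  have VG: "V \<subseteq> carrier G" using openin_subset[OF V(1)] top by simp
  obtain a :: "nat \<Rightarrow> 'v" where a: "\<And>n. a n \<in> P" and ev: "\<forall>g\<in>V. \<exists>N. \<forall>n\<ge>N. act g (a n) = a n"
    using eventually_fixed_sequence[OF VG V(3,4) p] by blast
  define H where "H N = (\<Inter>n\<in>{N..}. {g \<in> carrier G. act g (a n) = a n})" for N
  have Hclosed: "closedin T (H N)" for N
    unfolding H_def by (intro closedin_INT closed a) simp
  have "V \<subseteq> \<Union>(range H)"
    using ev VG unfolding H_def by fastforce
  then have "V \<subseteq> T interior_of \<Union>(range H)" using V(1) by (simp add: interior_of_maximal)
  then have "T interior_of \<Union>(range H) \<noteq> {}" using V(2) by blast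
  moreover have "regular_space T" using lc by (rule locally_compact_Hausdorff_imp_regular_space)
  ultimately obtain N where N: "T interior_of (H N) \<noteq> {}"
    using Baire_category_alt[of T "range H"] lc(1) Hclosed by auto
  have "T interior_of (H N) \<subseteq> {g \<in> carrier G. act g (a N) = a N}"
    using interior_of_subset[of T "H N"] unfolding H_def by auto
  then have "finite ((\<lambda>g. act g (a N)) ` carrier G)"
    by (intro finite_orbit_if_open_stabilizer[OF cont top fin a closed[OF a] openin_interior_of N])
  then show ?thesis using finite_orbit_fixed_point[OF a] by blast
qed

lemma (in amalgam) node_fixed_iff:
  assumes "g \<in> carrier G" "k \<in> carrier G"
  shows "(fst (node s k), g <#\<^bsub>G\<^esub> snd (node s k)) = node s k \<longleftrightarrow> inv k \<otimes> g \<otimes> k \<in> factor s"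
proof -
  have "g <#\<^bsub>G\<^esub> (k <#\<^bsub>G\<^esub> factor s) = (g \<otimes> k) <#\<^bsub>G\<^esub> factor s"
    using lcos_m_assoc[OF subgroup.subset[OF factor_subgroup]] assms by simp
  then have "(fst (node s k), g <#\<^bsub>G\<^esub> snd (node s k)) = node s k
      \<longleftrightarrow> (g \<otimes> k) <#\<^bsub>G\<^esub> factor s = k <#\<^bsub>G\<^esub> factor s"
    by (simp add: node_def)
  also have "\<dots> \<longleftrightarrow> inv k \<otimes> g \<otimes> k \<in> factor s"
  proof
    assume "(g \<otimes> k) <#\<^bsub>G\<^esub> factor s = k <#\<^bsub>G\<^esub> factor s"
    then obtain b where b: "b \<in> factor s" "g \<otimes> k = k \<otimes> b"
      using lcos_eqD[of k "g \<otimes> k" s] assms by auto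
    have "b \<in> carrier G" using b(1) subgroup.mem_carrier[OF factor_subgroup] by blast
    have "inv k \<otimes> g \<otimes> k = inv k \<otimes> (k \<otimes> b)" using assms b(2) by (simp add: m_assoc)
    also have "\<dots> = b" using assms \<open>b \<in> carrier G\<close> by (simp flip: m_assoc)
    finally show "inv k \<otimes> g \<otimes> k \<in> factor s" using b(1) by simp
  next
    assume b: "inv k \<otimes> g \<otimes> k \<in> factor s"
    have "k \<otimes> (inv k \<otimes> g \<otimes> k) = g \<otimes> k" using assms by (simp flip: m_assoc)
    then show "(g \<otimes> k) <#\<^bsub>G\<^esub> factor s = k <#\<^bsub>G\<^esub> factor s"
      using lcos_mult[OF assms(2) b] by simp
  qed
  finally show ?thesis .
qed

lemma conjugate_of_image:
  assumes "group \<G>" "group G" "\<phi> \<in> hom G \<G>" "subgroup S \<G>" and k: "k \<in> carrier \<G>"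
    and fixed: "\<And>g. g \<in> carrier G \<Longrightarrow> inv\<^bsub>\<G>\<^esub> k \<otimes>\<^bsub>\<G>\<^esub> \<phi> g \<otimes>\<^bsub>\<G>\<^esub> k \<in> S"
  shows "\<exists>H. subgroup H (\<G>\<lparr>carrier := S\<rparr>) \<and> conjugate_subgroups \<G> (\<phi> ` carrier G) H"
proof -
  interpret C: group \<G> by fact
  interpret h: group_hom G \<G> \<phi> using assms by (simp add: group_hom_def group_hom_axioms_def)
  define c where "c x = inv\<^bsub>\<G>\<^esub> k \<otimes>\<^bsub>\<G>\<^esub> x \<otimes>\<^bsub>\<G>\<^esub> k" for x
  have c_hom: "c \<in> hom \<G> \<G>"
  proof (rule homI)
    fix x y assume xy: "x \<in> carrier \<G>" "y \<in> carrier \<G>"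
    have "c x \<otimes>\<^bsub>\<G>\<^esub> c y = inv\<^bsub>\<G>\<^esub> k \<otimes>\<^bsub>\<G>\<^esub> x \<otimes>\<^bsub>\<G>\<^esub> (k \<otimes>\<^bsub>\<G>\<^esub> (inv\<^bsub>\<G>\<^esub> k \<otimes>\<^bsub>\<G>\<^esub> y \<otimes>\<^bsub>\<G>\<^esub> k))"
      using xy k by (simp add: c_def C.m_assoc)
    also have "k \<otimes>\<^bsub>\<G>\<^esub> (inv\<^bsub>\<G>\<^esub> k \<otimes>\<^bsub>\<G>\<^esub> y \<otimes>\<^bsub>\<G>\<^esub> k) = y \<otimes>\<^bsub>\<G>\<^esub> k"
      using xy k by (simp flip: C.m_assoc)
    finally show "c (x \<otimes>\<^bsub>\<G>\<^esub> y) = c x \<otimes>\<^bsub>\<G>\<^esub> c y" using xy k by (simp add: c_def C.m_assoc)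
  qed (use k in \<open>simp add: c_def\<close>)
  have "subgroup (\<phi> ` carrier G) \<G>" by (rule h.img_is_subgroup)
  then have "subgroup (c ` \<phi> ` carrier G) \<G>"
    by (rule group_hom.subgroup_img_is_subgroup[rotated])
      (use c_hom C.is_group in \<open>simp add: group_hom_def group_hom_axioms_def\<close>)
  moreover have "c ` \<phi> ` carrier G \<subseteq> S" using fixed by (auto simp: c_def)
  ultimately have "subgroup (c ` \<phi> ` carrier G) (\<G>\<lparr>carrier := S\<rparr>)"
    using C.subgroup_incl assms(4) by blast
  moreover have "c ` \<phi> ` carrier G = inv\<^bsub>\<G>\<^esub> k <#\<^bsub>\<G>\<^esub> (\<phi> ` carrier G) #>\<^bsub>\<G>\<^esub> inv\<^bsub>\<G>\<^esub> (inv\<^bsub>\<G>\<^esub> k)"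
    using k by (auto simp: c_def l_coset_def r_coset_def)
  then have "conjugate_subgroups \<G> (\<phi> ` carrier G) (c ` \<phi> ` carrier G)"
    unfolding conjugate_subgroups_def using k by (intro bexI[of _ "inv\<^bsub>\<G>\<^esub> k"]) simp_all
  ultimately show ?thesis by blast
qed

theorem theorem1p4:
  fixes \<G> :: "('a, 'm) monoid_scheme" and T\<^sub>\<G> :: "'a topology"
    and O1 L1 :: "'a set"
    and G :: "('g, 'n) monoid_scheme" and T\<^sub>G :: "'g topology"
    and \<A> :: "('g, 'e::real_normed_vector) chart set"
    and \<phi> :: "'g \<Rightarrow> 'a"
  assumes "topological_group \<G> T\<^sub>\<G>"
    and "closedin T\<^sub>\<G> O1" and "closedin T\<^sub>\<G> L1"
    and "is_amalgamated_product_of_subgroups \<G> O1 L1"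
    and "lie_group G T\<^sub>G \<A>"
    and "finite (connected_components_of T\<^sub>G)"
    and "\<phi> \<in> hom G \<G>" and "continuous_map T\<^sub>G T\<^sub>\<G> \<phi>"
  shows "\<exists>H. (subgroup H (\<G>\<lparr>carrier := O1\<rparr>) \<or> subgroup H (\<G>\<lparr>carrier := L1\<rparr>)) \<and>
             conjugate_subgroups \<G> (\<phi> ` carrier G) H"
proof -
  note \<phi> = \<open>\<phi> \<in> hom G \<G>\<close> and contphi = \<open>continuous_map T\<^sub>G T\<^sub>\<G> \<phi>\<close>
  have "group \<G>" and top\<G>: "topspace T\<^sub>\<G> = carrier \<G>"
    and cont\<G>: "continuous_map (prod_topology T\<^sub>\<G> T\<^sub>\<G>) T\<^sub>\<G> (\<lambda>(x, y). x \<otimes>\<^bsub>\<G>\<^esub> y)"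
    using assms(1) by (auto simp: topological_group_def)
  have "group G" and top: "topspace T\<^sub>G = carrier G" and man: "smooth_manifold T\<^sub>G \<A>"
    using assms(5) by (auto simp: lie_group_def)
  interpret C: amalgam \<G> O1 L1
    using \<open>group \<G>\<close> assms(4) by (simp add: amalgam_def amalgam_axioms_def)
  interpret tree_action C.edges fst G "\<lambda>h p. (fst p, \<phi> h <#\<^bsub>\<G>\<^esub> snd p)"
    using C.coset_action[OF \<open>group G\<close> \<phi>] .
  have \<phi>G: "\<phi> g \<in> carrier \<G>" if "g \<in> carrier G" for g using hom_in_carrier[OF \<phi> that] .
  have closed: "closedin T\<^sub>G {g \<in> carrier G. (fst x, \<phi> g <#\<^bsub>\<G>\<^esub> snd x) = x}" if x: "x \<in> Field C.edges" for x
  proof -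
    obtain s k where k: "k \<in> carrier \<G>" "x = C.node s k" using x by (rule C.Field_edgesE)
    have "closedin T\<^sub>\<G> (C.factor s)" using assms(2,3) by (simp add: C.factor_def)
    moreover have "continuous_map T\<^sub>G T\<^sub>\<G> (\<lambda>g. inv\<^bsub>\<G>\<^esub> k \<otimes>\<^bsub>\<G>\<^esub> \<phi> g \<otimes>\<^bsub>\<G>\<^esub> k)"
    proof -
      have "continuous_map T\<^sub>\<G> (prod_topology T\<^sub>\<G> T\<^sub>\<G>) (\<lambda>x. (x, k))"
        using k(1) top\<G> by (simp add: continuous_map_pairedI)
      from continuous_map_compose[OF this cont\<G>]
      have R: "continuous_map T\<^sub>\<G> T\<^sub>\<G> (\<lambda>x. x \<otimes>\<^bsub>\<G>\<^esub> k)" by (simp add: o_def)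
      have L: "continuous_map T\<^sub>\<G> T\<^sub>\<G> (\<lambda>x. inv\<^bsub>\<G>\<^esub> k \<otimes>\<^bsub>\<G>\<^esub> x)"
        using left_translation_continuous[OF \<open>group \<G>\<close> cont\<G> top\<G>] k(1) by simp
      show ?thesis
        using continuous_map_compose[OF continuous_map_compose[OF contphi L] R] by (simp add: o_def)
    qed
    ultimately have "closedin T\<^sub>G {g \<in> topspace T\<^sub>G. inv\<^bsub>\<G>\<^esub> k \<otimes>\<^bsub>\<G>\<^esub> \<phi> g \<otimes>\<^bsub>\<G>\<^esub> k \<in> C.factor s}"
      using closedin_continuous_map_preimage by blast
    then show ?thesis
      unfolding k(2) top using C.node_fixed_iff[OF \<phi>G k(1)] by (simp cong: conj_cong)
  qed
  have p: "C.node True \<one>\<^bsub>\<G>\<^esub> \<in> Field C.edges" unfolding C.Field_edges using C.one_closed by blast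
  obtain W where W: "openin T\<^sub>G W" "\<one>\<^bsub>G\<^esub> \<in> W" and roots: "\<And>w. w \<in> W \<Longrightarrow> \<exists>h\<in>W. h \<otimes>\<^bsub>G\<^esub> h = w"
    using lie_group_square_roots[OF assms(5)] by blast
  have WG: "W \<subseteq> carrier G" using openin_subset[OF W(1)] top by simp
  have ell: "elliptic w" if "w \<in> W" for w
    using elliptic_if_roots[OF WG roots that p] .
  obtain V where V: "openin T\<^sub>G V" "\<one>\<^bsub>G\<^esub> \<in> V" "V \<subseteq> W" "\<And>x y. x \<in> V \<Longrightarrow> y \<in> V \<Longrightarrow> x \<otimes>\<^bsub>G\<^esub> y \<in> W"
    using lie_group_small_products[OF assms(5) W] by blast
  have "\<exists>x\<in>Field C.edges. \<forall>g\<in>carrier G. (fst x, \<phi> g <#\<^bsub>\<G>\<^esub> snd x) = x"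
  proof (rule fixed_point_if_locally_elliptic[OF lie_group_mult_continuous[OF assms(5)] top assms(6) _ _ p closed V(1)])
    show "locally_compact_space T\<^sub>G" using manifold_locally_compact[OF man] .
    show "Hausdorff_space T\<^sub>G" using man by (simp add: smooth_manifold_def)
  qed (use V ell in auto)
  then obtain x where x: "x \<in> Field C.edges" "\<And>g. g \<in> carrier G \<Longrightarrow> (fst x, \<phi> g <#\<^bsub>\<G>\<^esub> snd x) = x"
    by blast
  obtain s k where k: "k \<in> carrier \<G>" "x = C.node s k" using x(1) by (rule C.Field_edgesE)
  have "inv\<^bsub>\<G>\<^esub> k \<otimes>\<^bsub>\<G>\<^esub> \<phi> g \<otimes>\<^bsub>\<G>\<^esub> k \<in> C.factor s" if "g \<in> carrier G" for g
    using C.node_fixed_iff[OF \<phi>G[OF that] k(1)] x(2)[OF that] unfolding k(2) by simp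
  then obtain H where "subgroup H (\<G>\<lparr>carrier := C.factor s\<rparr>)" "conjugate_subgroups \<G> (\<phi> ` carrier G) H"
    using conjugate_of_image[OF \<open>group \<G>\<close> \<open>group G\<close> \<phi> C.factor_subgroup k(1)] by blast
  then show ?thesis unfolding C.factor_def by (cases s) auto
qed

end
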